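(* Let $g=g_1\cdots g_s\in K[[X]][Y]$ be the decomposition of a square-free monic polynomial $g$ of degree $m\geq1$ in $Y$ into its irreducible (monic) factors, with $m_i=\deg_Yg_i$. For each $i$ let $\left\{1=p_0^{(i)},\frac{p_1^{(i)}}{X^{e_1^{(i)}}},\ldots,\frac{p_{m_i-1}^{(i)}}{X^{e_{m_i-1}^{(i)}}}\right\}$ represent an integral basis for $g_i$, with $p_d^{(i)}\in K[[X]][Y]$ monic of degree $d$ in $Y$. Put $h_i=\prod_{j\ne i}g_j$, let $a_i,b_i\in K[[X]][Y]$, $c_i\in\mathbb{N}$ satisfy $a_ig_i+b_ih_i=X^{c_i}$, and set $$\widetilde{\mathcal{B}}^{(i)}=\left\{\frac{b_ih_ip_d^{(i)}}{X^{c_i+e_d^{(i)}}}\ :\ 0\le d\le m_i-1\right\}\qquad(e_0^{(i)}=0).$$ Let $$\overline{\mathcal{B}}=\left\{p_0(x,y),\frac{p_1(x,y)}{x^{e_1}},\ldots,\frac{p_{m-1}(x,y)}{x^{e_{m-1}}}\right\}$$ be obtained from $\widetilde{\mathcal{B}}^{(1)}\cup\ldots\cup\widetilde{\mathcal{B}}^{(s)}$ by the Hermite normal form procedure described in the context. Then $\overline{\mathcal{B}}$ is an integral basis for $g$ of monic triangular type.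
   Context: $K$ is a field of characteristic zero. For a square-free monic $g\in K[[X]][Y]$ of degree $m\ge1$ in $Y$, let $B=K[[x]][y]=K[[X]][Y]/\langle g\rangle$, with $x,y$ the residue classes of $X,Y$. The normalization $\overline{B}$ is the integral closure of $B$ in its total ring of fractions $K((X))[Y]/\langle g\rangle$; it is a free $K[[x]]$-module of rank $m$. An integral basis for $g$ is a set of free generators of $\overline{B}$ over $K[[x]]$. A set of elements of $K((X))[Y]$ represents an integral basis for $g$ if their residue classes modulo $g$ form one. An integral basis for $g$ is of monic triangular type if it has the form $\left\{1=p_0,\frac{p_1(x,y)}{x^{e_1}},\dots,\frac{p_{m-1}(x,y)}{x^{e_{m-1}}}\right\}$ with $p_d\in K[X][Y]$ monic of degree $d$ in $Y$ and $e_d$ integers. Hermite normal form: each matrix $M$ over the PID $K[[X]]$ of maximal column rank can be transformed by unimodular row operations to a uniquely determined upper triangular matrix $H=(p_{ij})$ whose diagonal entries are $p_{ii}=X^{\nu_i}$ and whose entries $p_{ij}$ with $j>i$ are polynomials in $K[X]$ of degree $<\nu_j$. Procedure: Represent the given $K[[x]]$-module generators by polynomials $c_i=\sum_{j=0}^{m-1}c_{ij}Y^{m-1-j}$ of $Y$-degree at most $m-1$ (reducing modulo $g$), with $c_{ij}\in K((X))$. Let $D$ (a power of $X$) be the least common denominator of the $c_{ij}$, and transform the matrix $(D\cdot c_{ij})$ into Hermite normal form $H=(p_{ij})_{0\le i,j\le m-1}$. For $i=0,\dots,m-1$ set $\widetilde{p}_i=\sum_{j=0}^{m-1}p_{m-1-i,j}Y^{m-1-j}$,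 a polynomial in $K[X][Y]$ of degree $i$ in $Y$, and let $p_i(X,Y)/X^{e_i}$ be obtained from $\widetilde{p}_i(X,Y)/D$ by reducing to lowest terms (cancelling the largest common power of $X$). *)

theory Defs
  imports
    "HOL-Algebra.Algebraic_Closure_Type"
    "Jordan_Normal_Form.Matrix"
    "HOL-Computational_Algebra.Computational_Algebra"
begin

section \<open>The normalization of \<open>K[[X]][Y]/(g)\<close>\<close>

text \<open>
  \<open>K[[X]]\<close> is \<open>'a fps\<close> and \<open>K((X))\<close> is \<open>'a fls\<close>. In bivariate polynomials, \<open>Y\<close> is the variable
  of the (outer) type constructor \<open>poly\<close>.
\<close>

definition lift_poly :: "'a::field fps poly \<Rightarrow> 'a fls poly" where
  "lift_poly = map_poly fps_to_fls"

definition frac_X :: "'a::field fps poly \<Rightarrow> int \<Rightarrow> 'a fls poly" where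
  "frac_X p e = smult (1 / fls_X powi e) (lift_poly p)"

text \<open>The total ring of fractions \<open>K((X))[Y]/(g)\<close> of \<open>K[[X]][Y]/(g)\<close>; its elements are cosets.\<close>

definition total_frac_ring :: "'a::field fps poly \<Rightarrow> 'a fls poly set ring" where
  "total_frac_ring g =
     ring_of_type_algebra Quot (PIdl\<^bsub>ring_of_type_algebra\<^esub> (lift_poly g))"

definition residue :: "'a::field fps poly \<Rightarrow> 'a fls poly \<Rightarrow> 'a fls poly set" where
  "residue g f =
     (PIdl\<^bsub>ring_of_type_algebra\<^esub> (lift_poly g)) +>\<^bsub>ring_of_type_algebra\<^esub> f"

text \<open>
  The rings \<open>B = K[[x]][y]\<close> and \<open>K[[x]]\<close>, as subrings of the total ring of fractions. For monic \<open>g\<close>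
  the natural map from \<open>K[[X]][Y]/(g)\<close> to \<open>K((X))[Y]/(g)\<close> is injective.
\<close>

definition coord_ring :: "'a::field fps poly \<Rightarrow> 'a fls poly set set" where
  "coord_ring g = range (\<lambda>f. residue g (lift_poly f))"

definition base_ring :: "'a::field fps poly \<Rightarrow> 'a fls poly set set" where
  "base_ring g = range (\<lambda>a. residue g (lift_poly [:a:]))"

definition integral_over :: "('b, 'c) ring_scheme \<Rightarrow> 'b set \<Rightarrow> 'b \<Rightarrow> bool" where
  "integral_over R A z \<longleftrightarrow>
     (\<exists>(n::nat) c. (\<forall>k<n. c k \<in> A) \<and>
        (z [^]\<^bsub>R\<^esub> n) \<oplus>\<^bsub>R\<^esub> (\<Oplus>\<^bsub>R\<^esub>k\<in>{..<n}. c k \<otimes>\<^bsub>R\<^esub> (z [^]\<^bsub>R\<^esub> k)) = \<zero>\<^bsub>R\<^esub>)"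

definition integral_closure :: "('b, 'c) ring_scheme \<Rightarrow> 'b set \<Rightarrow> 'b set" where
  "integral_closure R A = {z \<in> carrier R. integral_over R A z}"

definition normalization :: "'a::field fps poly \<Rightarrow> 'a fls poly set set" where
  "normalization g = integral_closure (total_frac_ring g) (coord_ring g)"

text \<open>
  \<open>S\<close> is a (finite) set of free generators of the \<open>A\<close>-module \<open>M\<close>, where \<open>A\<close> is a subring of \<open>R\<close>
  and \<open>M\<close> an \<open>A\<close>-submodule of \<open>R\<close>: taking linear combinations is a bijection from \<open>A\<^sup>S\<close> to \<open>M\<close>.
\<close>

definition free_generators :: "('b, 'c) ring_scheme \<Rightarrow> 'b set \<Rightarrow> 'b set \<Rightarrow> 'b set \<Rightarrow> bool" where
  "free_generators R A M S \<longleftrightarrow> finite S \<and> S \<subseteq> M \<and>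
     bij_betw (\<lambda>c. \<Oplus>\<^bsub>R\<^esub>z\<in>S. c z \<otimes>\<^bsub>R\<^esub> z) (S \<rightarrow>\<^sub>E A) M"

definition integral_basis :: "'a::field fps poly \<Rightarrow> 'a fls poly set set \<Rightarrow> bool" where
  "integral_basis g S \<longleftrightarrow>
     free_generators (total_frac_ring g) (base_ring g) (normalization g) S"

definition represents_integral_basis :: "'a::field fps poly \<Rightarrow> 'a fls poly set \<Rightarrow> bool" where
  "represents_integral_basis g F \<longleftrightarrow> integral_basis g (residue g ` F)"

text \<open>
  The set of all \<open>p\<^sub>d(x,y)/x\<^bsup>e\<^sub>d\<^esup>\<close>, \<open>d < deg g\<close>, is an integral basis for \<open>g\<close> of monic triangular
  type. Here the \<open>p\<^sub>d\<close> lie in \<open>K[X][Y]\<close>.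
\<close>

definition triangular_set ::
  "'a::field fps poly \<Rightarrow> (nat \<Rightarrow> 'a poly poly) \<Rightarrow> (nat \<Rightarrow> int) \<Rightarrow> 'a fls poly set set" where
  "triangular_set g p e =
     (\<lambda>d. residue g (frac_X (map_poly fps_of_poly (p d)) (e d))) ` {..<degree g}"

definition monic_triangular_integral_basis ::
  "'a::field fps poly \<Rightarrow> (nat \<Rightarrow> 'a poly poly) \<Rightarrow> (nat \<Rightarrow> int) \<Rightarrow> bool" where
  "monic_triangular_integral_basis g p e \<longleftrightarrow>
     p 0 = 1 \<and> e 0 = 0 \<and>
     (\<forall>d<degree g. degree (p d) = d \<and> lead_coeff (p d) = 1) \<and>
     integral_basis g (triangular_set g p e)"


section \<open>The Hermite normal form procedure\<close>

text \<open>
  Hermite normal forms over \<open>K[[X]]\<close>. The entries of a normal form are polynomials in \<open>X\<close>. If \<open>M\<close>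
  has more rows than columns then so does \<open>H\<close>, the additional rows of \<open>H\<close> being zero.
\<close>

definition is_hermite_form :: "'a::field fps mat \<Rightarrow> 'a poly mat \<Rightarrow> bool" where
  "is_hermite_form M H \<longleftrightarrow>
     dim_row H = dim_row M \<and> dim_col H = dim_col M \<and> dim_col M \<le> dim_row M \<and>
     (\<exists>U \<in> carrier_mat (dim_row M) (dim_row M).
        invertible_mat U \<and> U * M = map_mat fps_of_poly H) \<and>
     (\<forall>i<dim_row H. \<forall>j<dim_col H. j < i \<longrightarrow> H $$ (i, j) = 0) \<and>
     (\<exists>\<nu> :: nat \<Rightarrow> nat.
        (\<forall>i<dim_col H. H $$ (i, i) = monom 1 (\<nu> i)) \<and>
        (\<forall>j<dim_col H. \<forall>i<j. H $$ (i, j) = 0 \<or> degree (H $$ (i, j)) < \<nu> j))"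

definition hermite_form :: "'a::field fps mat \<Rightarrow> 'a poly mat" where
  "hermite_form M = (THE H. is_hermite_form M H)"

text \<open>
  The generators are given as a list \<open>cs\<close> of polynomials in \<open>K((X))[Y]\<close>. Column \<open>j\<close> of the matrix
  belongs to \<open>Y\<^bsup>m-1-j\<^esup>\<close>, and the least common denominator of all coefficients is \<open>X\<close> to the
  power \<open>denom_exp g cs\<close>. On Laurent series without principal part, \<open>fls_regpart\<close> is the inverse
  of \<open>fps_to_fls\<close>.
\<close>

definition reduced :: "'a::field fps poly \<Rightarrow> 'a fls poly \<Rightarrow> 'a fls poly" where
  "reduced g f = f mod lift_poly g"

definition denom_exp :: "'a::field fps poly \<Rightarrow> 'a fls poly list \<Rightarrow> nat" where
  "denom_exp g cs =
     (LEAST k. \<forall>f\<in>set cs. \<forall>j. fls_X ^ k * coeff (reduced g f) j \<in> range fps_to_fls)"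

definition gens_mat :: "'a::field fps poly \<Rightarrow> 'a fls poly list \<Rightarrow> 'a fps mat" where
  "gens_mat g cs = mat (length cs) (degree g)
     (\<lambda>(i, j). fls_regpart
        (fls_X ^ denom_exp g cs * coeff (reduced g (cs ! i)) (degree g - 1 - j)))"

definition hnf_poly :: "'a::field fps poly \<Rightarrow> 'a fls poly list \<Rightarrow> nat \<Rightarrow> 'a poly poly" where
  "hnf_poly g cs d =
     (\<Sum>j<degree g. monom (hermite_form (gens_mat g cs) $$ (degree g - 1 - d, j)) (degree g - 1 - j))"

text \<open>
  Reduction of \<open>hnf_poly g cs d / X\<^bsup>denom_exp g cs\<^esup>\<close> to lowest terms: \<open>X\<^bsup>cancel_exp g cs d\<^esup>\<close> is the
  greatest common divisor of numerator and denominator.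
\<close>

definition cancel_exp :: "'a::field fps poly \<Rightarrow> 'a fls poly list \<Rightarrow> nat \<Rightarrow> nat" where
  "cancel_exp g cs d = Max {k. k \<le> denom_exp g cs \<and> [:monom 1 k:] dvd hnf_poly g cs d}"

definition hnf_num :: "'a::field fps poly \<Rightarrow> 'a fls poly list \<Rightarrow> nat \<Rightarrow> 'a poly poly" where
  "hnf_num g cs d = hnf_poly g cs d div [:monom 1 (cancel_exp g cs d):]"

definition hnf_exp :: "'a::field fps poly \<Rightarrow> 'a fls poly list \<Rightarrow> nat \<Rightarrow> int" where
  "hnf_exp g cs d = int (denom_exp g cs - cancel_exp g cs d)"

end

theory Submission
  imports Defs "Jordan_Normal_Form.Char_Poly"
begin

text \<open>
  Let \<open>N \<subseteq> K((X))[Y]\<close> be the preimage of the normalization. Everything is decided by divisibility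
  in \<open>K((X))[Y]\<close>: \<open>f\<close> lies in \<open>N\<close> iff \<open>g\<close> divides \<open>P(f)\<close> for some monic \<open>P\<close> over \<open>K[[X]][Y]\<close>
  (\<open>residue_in_normalization_iff\<close>), and elements of degrees \<open>0, \<dots>, m - 1\<close> form an integral basis
  iff \<open>N\<close> consists of their \<open>K[[X]]\<close>-combinations up to multiples of \<open>g\<close>
  (\<open>integral_basis_triangular_iff\<close>).

  The generators. Multiplying the equations for the factors shows that \<open>f\<close> is integral modulo \<open>g\<close> iff
  it is integral modulo every \<open>g\<^sub>i\<close> (\<open>integral_mod_prod_iff\<close>). Since \<open>b\<^sub>i h\<^sub>i / X^c\<^sub>i\<close> is \<open>1\<close> modulo \<open>g\<^sub>i\<close> and
  \<open>0\<close> modulo the other factors, the Chinese remainder theorem glues the given bases to \<open>m\<close> generators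
  of \<open>N\<close> modulo \<open>g\<close> (\<open>glued_gen_integral\<close>, \<open>glued_gen_generate\<close>).

  The normal form. After clearing the denominator \<open>X^D\<close>, the elements of \<open>N\<close> of degree less than \<open>m\<close>
  become a lattice \<open>\<Lambda>\<close> of polynomials over \<open>K[[X]]\<close>. Let \<open>X^\<mu>\<^sub>d\<close> be the least power of \<open>X\<close> that is the
  leading coefficient of an element of \<open>\<Lambda>\<close> of degree \<open>d\<close>. Rows of the Hermite normal form are elements
  of degree \<open>d\<close> with leading coefficient \<open>X^\<mu>\<^sub>d\<close> that are reduced against the lower ones; such a basis of
  \<open>\<Lambda>\<close> exists and the normal form is unique (\<open>reduced_triangular_basis\<close>, \<open>hermite_form_unique\<close>).

  Why the result is monic. In lowest terms the row of degree \<open>d\<close> is monic iff \<open>X^\<mu>\<^sub>d\<close> divides all its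
  coefficients. This holds since \<open>N\<close> is closed under multiplication by \<open>Y\<close>
  (\<open>lead_exp_dvd_coeff\<close>). Finally \<open>\<mu>\<^sub>0 = D\<close>, because the constants in \<open>N\<close> are just \<open>K[[X]]\<close>; therefore
  the first basis element is \<open>1\<close>.
\<close>

text \<open>
  This simplification procedure rewrites \<open>X^k\<close> to the image of a monomial and would loop with
  \<open>fps_of_poly_monom'\<close>.
\<close>
declare [[simproc del: poly_fps_eq]]

section \<open>Integrality as a congruence\<close>

interpretation fps_to_fls_hom: inj_idom_hom "fps_to_fls :: 'a::field fps \<Rightarrow> 'a fls"
  by unfold_locales (auto simp: fls_times_fps_to_fls)

interpretation lift_poly_hom: inj_idom_hom "lift_poly :: 'a::field fps poly \<Rightarrow> 'a fls poly"
proof -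
  interpret map_poly_inj_idom_hom "fps_to_fls :: 'a::field fps \<Rightarrow> 'a fls" ..
  show "inj_idom_hom (lift_poly :: 'a::field fps poly \<Rightarrow> 'a fls poly)"
    unfolding lift_poly_def by unfold_locales
qed

lemmas lift_poly_arith = lift_poly_hom.hom_add lift_poly_hom.hom_mult lift_poly_hom.hom_power
  lift_poly_hom.hom_uminus lift_poly_hom.hom_minus

lemma coeff_lift_poly [simp]: "coeff (lift_poly f) n = fps_to_fls (coeff f n)"
  by (simp add: lift_poly_def coeff_map_poly)

lemma degree_lift_poly [simp]: "degree (lift_poly f) = degree f"
  by (simp add: lift_poly_def degree_map_poly)

lemma lift_poly_smult [simp]: "lift_poly (smult a f) = smult (fps_to_fls a) (lift_poly f)"
  by (rule poly_eqI) (simp add: fls_times_fps_to_fls)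

lemma lift_poly_const [simp]: "lift_poly [:a:] = [:fps_to_fls a:]"
  by (rule poly_eqI) (simp add: coeff_pCons split: nat.split)

abbreviation poly_ring :: "'a::field fls poly ring" where
  "poly_ring \<equiv> ring_of_type_algebra"

lemma residue_ring_hom:
  "ring_hom_cring poly_ring (total_frac_ring g) (residue g)"
proof -
  interpret P: cring poly_ring by (rule cring_from_type_algebra)
  have "ideal (PIdl\<^bsub>poly_ring\<^esub> (lift_poly g)) poly_ring"
    by (rule P.cgenideal_ideal) (simp add: ring_of_type_algebra_def)
  then interpret I: ideal "PIdl\<^bsub>poly_ring\<^esub> (lift_poly g)" poly_ring .
  show ?thesis
    unfolding total_frac_ring_def residue_def[abs_def]
    by (rule I.rcos_ring_hom_cring) (rule P.is_cring)
qed

lemma residue_eq_iff: "residue g f = residue g f' \<longleftrightarrow> lift_poly g dvd f - f'"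
proof -
  interpret P: cring poly_ring by (rule cring_from_type_algebra)
  have I: "ideal (PIdl\<^bsub>poly_ring\<^esub> (lift_poly g)) poly_ring"
    by (rule P.cgenideal_ideal) (simp add: ring_of_type_algebra_def)
  have minus: "f \<ominus>\<^bsub>poly_ring\<^esub> f' = f - f'" for f f' :: "'a fls poly"
  proof -
    have "f \<ominus>\<^bsub>poly_ring\<^esub> f' \<oplus>\<^bsub>poly_ring\<^esub> f' = f"
      using P.add.inv_solve_right'[of "f \<ominus>\<^bsub>poly_ring\<^esub> f'" f f']
      by (simp add: ring_of_type_algebra_def a_minus_def)
    then show ?thesis
      by (simp add: ring_of_type_algebra_def algebra_simps)
  qed
  have "f - f' \<in> PIdl\<^bsub>poly_ring\<^esub> (lift_poly g) \<longleftrightarrow> lift_poly g dvd f - f'"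
    by (auto simp: cgenideal_def ring_of_type_algebra_def dvd_def mult.commute)
  then show ?thesis
    using P.quotient_eq_iff_same_a_r_cos[OF I, of f f']
    by (simp add: residue_def minus) (simp add: ring_of_type_algebra_def)
qed

lemma carrier_total_frac_ring: "carrier (total_frac_ring g) = range (residue g)"
  by (auto simp: total_frac_ring_def residue_def FactRing_def A_RCOSETS_defs a_r_coset_def
      ring_of_type_algebra_def)

lemma residue_hom:
  "residue g (f + f') = residue g f \<oplus>\<^bsub>total_frac_ring g\<^esub> residue g f'"
  "residue g (f * f') = residue g f \<otimes>\<^bsub>total_frac_ring g\<^esub> residue g f'"
  "residue g 0 = \<zero>\<^bsub>total_frac_ring g\<^esub>"
  "residue g (f ^ n) = residue g f [^]\<^bsub>total_frac_ring g\<^esub> n"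
  "residue g (sum F A) = (\<Oplus>\<^bsub>total_frac_ring g\<^esub>k\<in>A. residue g (F k))"
proof -
  interpret h: ring_hom_cring poly_ring "total_frac_ring g" "residue g"
    by (rule residue_ring_hom)
  have UNIV: "carrier poly_ring = (UNIV :: 'a fls poly set)"
    by (simp add: ring_of_type_algebra_def)
  show add: "residue g (f + f') = residue g f \<oplus>\<^bsub>total_frac_ring g\<^esub> residue g f'" for f f'
    using h.hom_add[of f f'] by (simp add: ring_of_type_algebra_def)
  show mult: "residue g (f * f') = residue g f \<otimes>\<^bsub>total_frac_ring g\<^esub> residue g f'" for f f'
    using h.hom_mult[of f f'] by (simp add: ring_of_type_algebra_def)
  show zero: "residue g 0 = \<zero>\<^bsub>total_frac_ring g\<^esub>"
    using h.hom_zero by (simp add: ring_of_type_algebra_def)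
  have one: "residue g 1 = \<one>\<^bsub>total_frac_ring g\<^esub>"
    using h.hom_one by (simp add: ring_of_type_algebra_def)
  have cl: "residue g f \<in> carrier (total_frac_ring g)" for f
    using h.hom_closed UNIV by auto
  show "residue g (f ^ n) = residue g f [^]\<^bsub>total_frac_ring g\<^esub> n"
  proof (induction n)
    case (Suc n)
    then show ?case by (simp add: mult mult.commute[of f])
  qed (simp add: one)
  show "residue g (sum F A) = (\<Oplus>\<^bsub>total_frac_ring g\<^esub>k\<in>A. residue g (F k))"
  proof (induction A rule: infinite_finite_induct)
    case (infinite A)
    then show ?case by (simp add: zero finsum_def finprod_def)
  next
    case empty
    then show ?case by (simp add: zero)
  next
    case (insert x A)
    then show ?case by (simp add: add cl)
  qed
qed

text \<open>
  Monic polynomials are closed under products, so integrality modulo several factors can be combined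
  directly; with explicit coefficient families this would be a convolution.
\<close>
definition integral_mod :: "'a::field fps poly \<Rightarrow> 'a fls poly \<Rightarrow> bool" where
  "integral_mod g f \<longleftrightarrow>
     (\<exists>P. lead_coeff P = 1 \<and> lift_poly g dvd poly (map_poly lift_poly P) f)"

lemma integral_mod_iff_sum:
  "integral_mod g f \<longleftrightarrow>
     (\<exists>n c. lift_poly g dvd f ^ n + (\<Sum>k<n. lift_poly (c k) * f ^ k))" (is "_ \<longleftrightarrow> ?R")
proof
  assume "integral_mod g f"
  then obtain P where P: "lead_coeff P = 1" "lift_poly g dvd poly (map_poly lift_poly P) f"
    by (auto simp: integral_mod_def)
  have "poly (map_poly lift_poly P) f = (\<Sum>k\<le>degree P. lift_poly (coeff P k) * f ^ k)"
    by (simp add: poly_altdef degree_map_poly coeff_map_poly)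
  also have "\<dots> = f ^ degree P + (\<Sum>k<degree P. lift_poly (coeff P k) * f ^ k)"
    using P(1) by (simp add: lessThan_Suc_atMost[symmetric] add.commute)
  finally show ?R using P(2) by metis
next
  assume ?R
  then obtain n c where nc: "lift_poly g dvd f ^ n + (\<Sum>k<n. lift_poly (c k) * f ^ k)" by auto
  define P where "P = monom 1 n + (\<Sum>k<n. monom (c k) k)"
  have co: "coeff P k = (if k = n then 1 else if k < n then c k else 0)" for k
    by (simp add: P_def coeff_sum)
  have deg: "degree P = n"
    by (rule antisym[OF degree_le le_degree]) (auto simp: co)
  have "poly (map_poly lift_poly P) f = (\<Sum>k\<le>n. lift_poly (coeff P k) * f ^ k)"
    by (simp add: poly_altdef degree_map_poly coeff_map_poly deg)
  also have "\<dots> = f ^ n + (\<Sum>k<n. lift_poly (c k) * f ^ k)"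
    by (simp add: lessThan_Suc_atMost[symmetric] add.commute co)
  finally show "integral_mod g f"
    using nc by (auto simp: integral_mod_def co deg intro!: exI[of _ P])
qed

text \<open>
  The passage from the quotient ring to polynomials: the residue map is a ring homomorphism whose
  kernel consists of the multiples of \<open>g\<close>, so an equation between residues is a divisibility.
\<close>
lemma residue_in_normalization_iff: "residue g f \<in> normalization g \<longleftrightarrow> integral_mod g f"
proof -
  let ?R = "total_frac_ring g"
  have eq: "(residue g f [^]\<^bsub>?R\<^esub> n) \<oplus>\<^bsub>?R\<^esub>
      (\<Oplus>\<^bsub>?R\<^esub>k\<in>{..<n}. c' k \<otimes>\<^bsub>?R\<^esub> (residue g f [^]\<^bsub>?R\<^esub> k)) = \<zero>\<^bsub>?R\<^esub> \<longleftrightarrow>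
      lift_poly g dvd f ^ n + (\<Sum>k<n. lift_poly (c k) * f ^ k)"
    if "\<forall>k<n. c' k = residue g (lift_poly (c k))" for n c c'
  proof -
    interpret h: ring_hom_cring poly_ring ?R "residue g"
      by (rule residue_ring_hom)
    have cl: "residue g f \<in> carrier ?R" for f
      by (simp add: carrier_total_frac_ring)
    have "(\<Oplus>\<^bsub>?R\<^esub>k\<in>{..<n}. c' k \<otimes>\<^bsub>?R\<^esub> (residue g f [^]\<^bsub>?R\<^esub> k)) =
        (\<Oplus>\<^bsub>?R\<^esub>k\<in>{..<n}. residue g (lift_poly (c k) * f ^ k))"
      using that by (intro h.S.finsum_cong') (auto simp: residue_hom cl)
    then show ?thesis
      using residue_eq_iff[of g "f ^ n + (\<Sum>k<n. lift_poly (c k) * f ^ k)" 0]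
      by (simp add: residue_hom)
  qed
  show ?thesis
  proof
    assume "residue g f \<in> normalization g"
    then obtain n :: nat and c' where c': "\<forall>k<n. c' k \<in> coord_ring g"
      "(residue g f [^]\<^bsub>?R\<^esub> n) \<oplus>\<^bsub>?R\<^esub>
      (\<Oplus>\<^bsub>?R\<^esub>k\<in>{..<n}. c' k \<otimes>\<^bsub>?R\<^esub> (residue g f [^]\<^bsub>?R\<^esub> k)) = \<zero>\<^bsub>?R\<^esub>"
      unfolding normalization_def integral_closure_def integral_over_def by blast
    from c'(1) have "\<forall>k. \<exists>c. k < n \<longrightarrow> c' k = residue g (lift_poly c)"
      by (auto simp: coord_ring_def)
    then obtain c where "\<forall>k<n. c' k = residue g (lift_poly (c k))" by metis
    from eq[OF this] c'(2) show "integral_mod g f"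
      by (auto simp: integral_mod_iff_sum)
  next
    assume "integral_mod g f"
    then obtain n c where nc: "lift_poly g dvd f ^ n + (\<Sum>k<n. lift_poly (c k) * f ^ k)"
      by (auto simp: integral_mod_iff_sum)
    have "integral_over ?R (coord_ring g) (residue g f)"
      unfolding integral_over_def using nc eq[of n "\<lambda>k. residue g (lift_poly (c k))" c]
      by (intro exI[of _ n] exI[of _ "\<lambda>k. residue g (lift_poly (c k))"])
         (auto simp: coord_ring_def)
    then show "residue g f \<in> normalization g"
      by (simp add: normalization_def integral_closure_def carrier_total_frac_ring)
  qed
qed

lemma integral_mod_cong:
  assumes "lift_poly g dvd f - f'"
  shows "integral_mod g f \<longleftrightarrow> integral_mod g f'"
  using assms by (simp only: residue_in_normalization_iff[symmetric] residue_eq_iff[symmetric])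

lemma integral_mod_lift [simp]: "integral_mod g (lift_poly r)"
  unfolding integral_mod_def by (rule exI[of _ "[:- r, 1:]"]) (simp add: map_poly_pCons lift_poly_arith)

text \<open>
  An equation for \<open>f\<close> of degree \<open>n\<close>, multiplied by \<open>r^n\<close>, is an equation for \<open>r f\<close>.
\<close>
lemma integral_mod_scale:
  assumes "integral_mod g f"
  shows "integral_mod g (lift_poly r * f)"
proof -
  obtain n c where nc: "lift_poly g dvd f ^ n + (\<Sum>k<n. lift_poly (c k) * f ^ k)"
    using assms by (auto simp: integral_mod_iff_sum)
  have "lift_poly r ^ n * (f ^ n + (\<Sum>k<n. lift_poly (c k) * f ^ k)) =
      (lift_poly r * f) ^ n + (\<Sum>k<n. lift_poly (c k * r ^ (n - k)) * (lift_poly r * f) ^ k)"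
  proof -
    have "lift_poly r ^ n * (lift_poly (c k) * f ^ k) =
        lift_poly (c k * r ^ (n - k)) * (lift_poly r * f) ^ k" if "k < n" for k
    proof -
      have "lift_poly r ^ n = lift_poly r ^ (n - k) * lift_poly r ^ k"
        using that by (simp add: power_add[symmetric])
      then show ?thesis by (simp add: lift_poly_arith power_mult_distrib ac_simps)
    qed
    then have "(\<Sum>k<n. lift_poly r ^ n * (lift_poly (c k) * f ^ k)) =
        (\<Sum>k<n. lift_poly (c k * r ^ (n - k)) * (lift_poly r * f) ^ k)"
      by (intro sum.cong refl) (simp only: lessThan_iff)
    then show ?thesis
      by (simp only: distrib_left sum_distrib_left power_mult_distrib)
  qed
  with dvd_mult[OF nc, of "lift_poly r ^ n"] show ?thesis
    unfolding integral_mod_iff_sum by (intro exI) (simp only:)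
qed

lemma integral_mod_smult:
  "integral_mod g f \<Longrightarrow> integral_mod g (smult (fps_to_fls a) f)"
  using integral_mod_scale[of g f "[:a:]"] by simp

text \<open>
  The product of the equations modulo \<open>g\<close> and modulo \<open>g'\<close> is an equation modulo \<open>g g'\<close>.
\<close>
lemma integral_mod_mult:
  assumes "integral_mod g f" "integral_mod g' f"
  shows "integral_mod (g * g') f"
proof -
  interpret map_poly_inj_idom_hom "lift_poly :: 'a fps poly \<Rightarrow> 'a fls poly" ..
  obtain P P' where P: "lead_coeff P = 1" "lift_poly g dvd poly (map_poly lift_poly P) f"
    "lead_coeff P' = 1" "lift_poly g' dvd poly (map_poly lift_poly P') f"
    using assms by (auto simp: integral_mod_def)
  have "map_poly lift_poly (P * P') = map_poly lift_poly P * map_poly lift_poly P'"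
    by (rule hom_mult)
  then have "lift_poly (g * g') dvd poly (map_poly lift_poly (P * P')) f"
    using mult_dvd_mono[OF P(2,4)] by (simp add: lift_poly_arith)
  moreover have "lead_coeff (P * P') = 1"
    using P by (simp only: lead_coeff_mult) simp
  ultimately show ?thesis
    unfolding integral_mod_def by blast
qed

lemma integral_mod_prod_iff:
  assumes "finite I"
  shows "integral_mod (\<Prod>i\<in>I. gs i) f \<longleftrightarrow> (\<forall>i\<in>I. integral_mod (gs i) f)"
proof
  assume "\<forall>i\<in>I. integral_mod (gs i) f"
  with assms show "integral_mod (\<Prod>i\<in>I. gs i) f"
  proof (induction I)
    case empty
    show ?case unfolding integral_mod_def by (rule exI[of _ 1]) simp
  qed (auto intro: integral_mod_mult)
next
  assume *: "integral_mod (\<Prod>i\<in>I. gs i) f"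
  show "\<forall>i\<in>I. integral_mod (gs i) f"
  proof
    fix i assume "i \<in> I"
    then have "gs i dvd (\<Prod>i\<in>I. gs i)" using assms by (rule dvd_prodI[rotated])
    then have "lift_poly (gs i) dvd lift_poly (\<Prod>i\<in>I. gs i)" by (rule lift_poly_hom.hom_dvd)
    then show "integral_mod (gs i) f" using * unfolding integral_mod_def by (meson dvd_trans)
  qed
qed

lemma inverse_power_int_shift:
  fixes x :: "'b::field"
  assumes "x \<noteq> 0"
  shows "1 / x powi n = 1 / x powi (int k + n) * x ^ k"
  using assms by (simp add: power_int_add)

lemma frac_X_nonzero: "p \<noteq> 0 \<Longrightarrow> frac_X p n \<noteq> 0"
  by (simp add: frac_X_def power_int_eq_0_iff)

lemma degree_frac_X [simp]: "degree (frac_X p n) = degree p"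
  by (simp add: frac_X_def power_int_eq_0_iff)

lemma frac_X_zero_exponent [simp]: "frac_X p 0 = lift_poly p"
  by (simp add: frac_X_def)

section \<open>Integral bases of triangular shape\<close>

lemma degree_combination_less:
  fixes F :: "nat \<Rightarrow> 'b::comm_ring_1 poly"
  assumes "\<And>d. d < m \<Longrightarrow> degree (F d) < m'" and "0 < m'"
  shows "degree (\<Sum>d<m. smult (u d) (F d)) < m'"
  by (rule degree_sum_less) (use assms degree_smult_le le_less_trans in blast)+

lemma triangular_combination_zero:
  fixes F :: "nat \<Rightarrow> 'b::idom poly"
  assumes "\<And>d. d < m \<Longrightarrow> F d \<noteq> 0 \<and> degree (F d) = d"
    and "(\<Sum>d<m. smult (u d) (F d)) = 0" and "d < m"
  shows "u d = 0"
  using assms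
proof (induction m)
  case (Suc m)
  have "coeff (\<Sum>d<m. smult (u d) (F d)) m = 0"
    unfolding coeff_sum using Suc.prems(1) by (intro sum.neutral) (auto simp: coeff_eq_0)
  then have "u m * coeff (F m) m = 0"
    using arg_cong[OF Suc.prems(2), of "\<lambda>q. coeff q m"] by simp
  moreover have "coeff (F m) m \<noteq> 0"
    using Suc.prems(1)[of m] by (metis leading_coeff_0_iff lessI)
  ultimately have "u m = 0" by simp
  then show ?case
    using Suc by (cases "d = m") auto
qed simp

text \<open>
  Generators of pairwise different degrees below \<open>deg g\<close> are independent over \<open>K((X))\<close> modulo \<open>g\<close>, as
  the degree of a nonzero combination is too small for a multiple of \<open>g\<close>. Hence freeness is automatic
  and only generation has to be checked. From left to right this exploits the bases given for the
  factors, from right to left it establishes the basis for \<open>g\<close>.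
\<close>
lemma integral_basis_triangular_iff:
  fixes F :: "nat \<Rightarrow> 'a::field fls poly"
  assumes F: "\<And>d. d < degree g \<Longrightarrow> F d \<noteq> 0 \<and> degree (F d) = d"
  shows "integral_basis g ((\<lambda>d. residue g (F d)) ` {..<degree g}) \<longleftrightarrow>
    (\<forall>f. integral_mod g f \<longleftrightarrow>
      (\<exists>u. lift_poly g dvd f - (\<Sum>d<degree g. smult (fps_to_fls (u d)) (F d))))"
proof -
  let ?R = "total_frac_ring g"
  define m where "m = degree g"
  define r where "r = (\<lambda>d. residue g (F d))"
  define S where "S = r ` {..<m}"
  define comb where "comb = (\<lambda>u. \<Sum>d<m. smult (fps_to_fls (u d)) (F d))"
  define \<Phi> where "\<Phi> = (\<lambda>c. \<Oplus>\<^bsub>?R\<^esub>z\<in>S. c z \<otimes>\<^bsub>?R\<^esub> z)"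
  interpret h: ring_hom_cring poly_ring ?R "residue g"
    by (rule residue_ring_hom)
  have cl: "residue g f \<in> carrier ?R" for f
    by (simp add: carrier_total_frac_ring)
  have comb_eq: "u d = v d"
    if "lift_poly g dvd comb u - comb v" "d < m" for u v d
  proof -
    have eq: "comb u - comb v = (\<Sum>d<m. smult (fps_to_fls (u d - v d)) (F d))"
      by (simp add: comb_def sum_subtractf smult_diff_left)
    have "degree (comb u - comb v) < m"
      unfolding eq by (rule degree_combination_less) (use F that m_def in auto)
    then have "comb u - comb v = 0"
      using that(1) dvd_imp_degree_le[of "lift_poly g"] unfolding m_def by fastforce
    then have "fps_to_fls (u d - v d) = 0"
      unfolding eq
      by (intro triangular_combination_zero[of m F "\<lambda>d. fps_to_fls (u d - v d)"])
         (use F that(2) m_def in auto)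
    then show ?thesis by simp
  qed
  have inj: "inj_on r {..<m}"
  proof (rule inj_onI)
    fix d d' assume d: "d \<in> {..<m}" "d' \<in> {..<m}" "r d = r d'"
    have unit: "comb (\<lambda>k. if k = j then 1 else 0) = F j" if "j < m" for j
    proof -
      have "comb (\<lambda>k. if k = j then 1 else 0) = (\<Sum>k<m. if k = j then F k else 0)"
        unfolding comb_def by (intro sum.cong) auto
      then show ?thesis using that by simp
    qed
    have "lift_poly g dvd comb (\<lambda>k. if k = d then 1 else 0) - comb (\<lambda>k. if k = d' then 1 else 0)"
      using d by (simp add: unit r_def residue_eq_iff)
    from comb_eq[OF this, of d] d show "d = d'" by (auto split: if_splits)
  qed
  \<comment> \<open>Linear combinations are indexed by the set of residues, whereas divisibility speaks of sequences of power series.\<close>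
  define coeff_fun where "coeff_fun = (\<lambda>u. \<lambda>z\<in>S. residue g (lift_poly [:u (inv_into {..<m} r z):]))"
  have \<Phi>_coeff_fun: "\<Phi> (coeff_fun u) = residue g (comb u)" for u
  proof -
    have "\<Phi> (coeff_fun u) = (\<Oplus>\<^bsub>?R\<^esub>d\<in>{..<m}. coeff_fun u (r d) \<otimes>\<^bsub>?R\<^esub> r d)"
      unfolding \<Phi>_def S_def by (rule h.S.finsum_reindex) (use inj in \<open>auto simp: coeff_fun_def S_def r_def cl\<close>)
    also have "\<dots> = (\<Oplus>\<^bsub>?R\<^esub>d\<in>{..<m}. residue g (smult (fps_to_fls (u d)) (F d)))"
    proof (rule h.S.finsum_cong')
      fix d assume "d \<in> {..<m}"
      then have "coeff_fun u (r d) = residue g [:fps_to_fls (u d):]"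
        using inj by (auto simp: coeff_fun_def S_def)
      then show "coeff_fun u (r d) \<otimes>\<^bsub>?R\<^esub> r d = residue g (smult (fps_to_fls (u d)) (F d))"
        by (simp add: r_def residue_hom(2)[symmetric])
    qed (auto simp: cl)
    finally show ?thesis by (simp add: comb_def residue_hom)
  qed
  have coeff_fun_mem: "coeff_fun u \<in> S \<rightarrow>\<^sub>E base_ring g" for u
    unfolding coeff_fun_def base_ring_def by (rule PiE_I) (simp_all del: lift_poly_const)
  have coeff_fun_surj: "\<exists>u. c = coeff_fun u" if c: "c \<in> S \<rightarrow>\<^sub>E base_ring g" for c
  proof -
    have "\<forall>d. \<exists>a. d < m \<longrightarrow> c (r d) = residue g (lift_poly [:a:])"
    proof (intro allI)
      fix d
      have "c (r d) \<in> base_ring g" if "d < m"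
        by (rule PiE_mem[OF c]) (use that S_def in auto)
      then show "\<exists>a. d < m \<longrightarrow> c (r d) = residue g (lift_poly [:a:])"
        unfolding base_ring_def by blast
    qed
    then obtain u where u: "\<And>d. d < m \<Longrightarrow> c (r d) = residue g (lift_poly [:u d:])" by metis
    have "c z = coeff_fun u z" for z
    proof (cases "z \<in> S")
      case True
      then obtain d where d: "d < m" "z = r d" by (auto simp: S_def)
      then have "inv_into {..<m} r z = d" using inj by simp
      then have "coeff_fun u z = residue g (lift_poly [:u d:])"
        using True unfolding coeff_fun_def by (simp only: restrict_apply if_True)
      then show ?thesis using u[OF d(1)] d(2) by (simp only:)
    next
      case False
      then show ?thesis using PiE_arb[OF c False] by (simp add: coeff_fun_def)
    qed
    then show ?thesis by blast
  qed
  have inj_\<Phi>: "inj_on \<Phi> (S \<rightarrow>\<^sub>E base_ring g)"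
  proof (rule inj_onI)
    fix c c' assume cc: "c \<in> S \<rightarrow>\<^sub>E base_ring g" "c' \<in> S \<rightarrow>\<^sub>E base_ring g" "\<Phi> c = \<Phi> c'"
    from coeff_fun_surj[OF cc(1)] coeff_fun_surj[OF cc(2)]
    obtain u v where uv: "c = coeff_fun u" "c' = coeff_fun v" by blast
    then have "lift_poly g dvd comb u - comb v"
      using cc by (simp add: \<Phi>_coeff_fun residue_eq_iff)
    then have "u d = v d" if "d < m" for d using comb_eq that by blast
    then show "c = c'"
      unfolding uv coeff_fun_def by (intro restrict_ext) (use inj in \<open>auto simp: S_def\<close>)
  qed
  have im: "\<Phi> ` (S \<rightarrow>\<^sub>E base_ring g) = range (\<lambda>u. residue g (comb u))"
  proof (rule Set.set_eqI, rule iffI)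
    fix z assume "z \<in> \<Phi> ` (S \<rightarrow>\<^sub>E base_ring g)"
    then obtain c where c: "c \<in> S \<rightarrow>\<^sub>E base_ring g" "z = \<Phi> c" by (rule imageE) simp
    obtain u where "c = coeff_fun u" using coeff_fun_surj[OF c(1)] by blast
    then show "z \<in> range (\<lambda>u. residue g (comb u))" using c(2) \<Phi>_coeff_fun[of u] by blast
  next
    fix z assume "z \<in> range (\<lambda>u. residue g (comb u))"
    then obtain u where "z = residue g (comb u)" by (rule imageE)
    then show "z \<in> \<Phi> ` (S \<rightarrow>\<^sub>E base_ring g)"
      by (metis \<Phi>_coeff_fun coeff_fun_mem image_eqI)
  qed
  have "S \<subseteq> range (\<lambda>u. residue g (comb u))"
  proof
    fix z assume "z \<in> S"
    then obtain d where d: "d < m" "z = residue g (F d)" by (auto simp: S_def r_def)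
    have "comb (\<lambda>k. if k = d then 1 else 0) = (\<Sum>k<m. if k = d then F k else 0)"
      unfolding comb_def by (intro sum.cong) auto
    then show "z \<in> range (\<lambda>u. residue g (comb u))"
      using d by (intro image_eqI[of _ _ "\<lambda>k. if k = d then 1 else 0"]) auto
  qed
  moreover have "finite S" by (simp add: S_def)
  ultimately have "integral_basis g S \<longleftrightarrow> range (\<lambda>u. residue g (comb u)) = normalization g"
    unfolding integral_basis_def free_generators_def bij_betw_def \<Phi>_def[symmetric] im
    using inj_\<Phi> by blast
  also have "\<dots> \<longleftrightarrow> (\<forall>f. residue g f \<in> normalization g \<longleftrightarrow> residue g f \<in> range (\<lambda>u. residue g (comb u)))"
  proof -
    have "normalization g \<subseteq> range (residue g)"
      by (auto simp: normalization_def integral_closure_def carrier_total_frac_ring)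
    then show ?thesis by blast
  qed
  also have "\<dots> \<longleftrightarrow> (\<forall>f. integral_mod g f \<longleftrightarrow> (\<exists>u. lift_poly g dvd f - comb u))"
    by (simp add: residue_in_normalization_iff image_iff residue_eq_iff)
  finally show ?thesis
    by (simp add: S_def r_def comb_def m_def)
qed

section \<open>Splitting along the factors\<close>

text \<open>
  The Chinese remainder situation: integral bases for the irreducible factors and Bezout cofactors
  up to powers of \<open>X\<close>.
\<close>
locale factor_bases =
  fixes g :: "'a::field fps poly" and s :: nat and gs :: "nat \<Rightarrow> 'a fps poly"
    and p :: "nat \<Rightarrow> nat \<Rightarrow> 'a fps poly" and e :: "nat \<Rightarrow> nat \<Rightarrow> int"
    and h a b :: "nat \<Rightarrow> 'a fps poly" and c :: "nat \<Rightarrow> nat"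
  assumes degree_g: "degree g \<ge> 1"
    and g_eq: "g = (\<Prod>i<s. gs i)"
    and irred: "\<And>i. i < s \<Longrightarrow> irreducible (gs i)"
    and monic: "\<And>i. i < s \<Longrightarrow> lead_coeff (gs i) = 1"
    and p_0: "\<And>i. i < s \<Longrightarrow> p i 0 = 1 \<and> e i 0 = 0"
    and p_monic: "\<And>i d. i < s \<Longrightarrow> d < degree (gs i) \<Longrightarrow> degree (p i d) = d \<and> lead_coeff (p i d) = 1"
    and basis: "\<And>i. i < s \<Longrightarrow>
      represents_integral_basis (gs i) {frac_X (p i d) (e i d) | d. d < degree (gs i)}"
    and h_eq: "\<And>i. i < s \<Longrightarrow> h i = (\<Prod>j\<in>{..<s} - {i}. gs j)"
    and bezout: "\<And>i. i < s \<Longrightarrow> a i * gs i + b i * h i = [:fps_X ^ c i:]"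
begin

definition local_gen :: "nat \<Rightarrow> nat \<Rightarrow> 'a fls poly" where
  "local_gen i d = frac_X (p i d) (e i d)"

definition glued_gen :: "nat \<Rightarrow> nat \<Rightarrow> 'a fls poly" where
  "glued_gen i d = frac_X (b i * h i * p i d) (int (c i) + e i d)"

lemma local_gen_degree:
  "i < s \<Longrightarrow> d < degree (gs i) \<Longrightarrow> local_gen i d \<noteq> 0 \<and> degree (local_gen i d) = d"
proof -
  assume *: "i < s" "d < degree (gs i)"
  then have "p i d \<noteq> 0" using p_monic[of i d] by auto
  then show ?thesis using p_monic[OF *] by (simp add: local_gen_def frac_X_nonzero)
qed

lemma local_gen_0: "i < s \<Longrightarrow> local_gen i 0 = 1"
  using p_0 by (simp add: local_gen_def)

lemma degree_factor_pos: "i < s \<Longrightarrow> 0 < degree (gs i)"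
proof (rule ccontr)
  assume "i < s" "\<not> 0 < degree (gs i)"
  then have "gs i = 1" using monic[of i] by (auto elim: degree_eq_zeroE)
  then show False using irred[OF \<open>i < s\<close>] by simp
qed

lemma integral_mod_factor_iff:
  assumes "i < s"
  shows "integral_mod (gs i) f \<longleftrightarrow>
    (\<exists>u. lift_poly (gs i) dvd f - (\<Sum>d<degree (gs i). smult (fps_to_fls (u d)) (local_gen i d)))"
proof -
  have "residue (gs i) ` {frac_X (p i d) (e i d) | d. d < degree (gs i)} =
      (\<lambda>d. residue (gs i) (local_gen i d)) ` {..<degree (gs i)}"
    by (auto simp: local_gen_def)
  then have "integral_basis (gs i) ((\<lambda>d. residue (gs i) (local_gen i d)) ` {..<degree (gs i)})"
    using basis[OF assms] by (simp add: represents_integral_basis_def)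
  then show ?thesis
    using integral_basis_triangular_iff[of "gs i" "local_gen i"] local_gen_degree[OF assms] by blast
qed

lemma integral_mod_iff: "integral_mod g f \<longleftrightarrow> (\<forall>i<s. integral_mod (gs i) f)"
  unfolding g_eq using integral_mod_prod_iff[of "{..<s}" gs f] by auto

text \<open>
  The bases for the factors exhibit the integral elements modulo each factor as a module.
\<close>
lemma integral_mod_add:
  assumes "integral_mod g f" "integral_mod g f'"
  shows "integral_mod g (f + f')"
  unfolding integral_mod_iff
proof (intro allI impI)
  fix i assume i: "i < s"
  let ?comb = "\<lambda>u. \<Sum>d<degree (gs i). smult (fps_to_fls (u d)) (local_gen i d)"
  obtain u u' where u: "lift_poly (gs i) dvd f - ?comb u" "lift_poly (gs i) dvd f' - ?comb u'"
    using assms integral_mod_factor_iff[OF i] i unfolding integral_mod_iff by blast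
  have "f + f' - ?comb (\<lambda>d. u d + u' d) = (f - ?comb u) + (f' - ?comb u')"
    by (simp add: smult_add_left sum.distrib)
  then have "lift_poly (gs i) dvd f + f' - ?comb (\<lambda>d. u d + u' d)"
    using dvd_add[OF u] by metis
  then show "integral_mod (gs i) (f + f')"
    unfolding integral_mod_factor_iff[OF i] by (rule exI[of _ "\<lambda>d. u d + u' d"])
qed

text \<open>
  The basis of a factor is triangular and starts with \<open>1\<close>, so a constant that is a combination of it
  has all higher coefficients zero and equals the lowest one.
\<close>
lemma integral_mod_const:
  assumes "integral_mod g [:x:]"
  shows "x \<in> range fps_to_fls"
proof -
  have s: "0 < s" using degree_g g_eq by (cases s) auto
  let ?m = "degree (gs 0)"
  have m: "0 < ?m" by (rule degree_factor_pos[OF s])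
  obtain u where u: "lift_poly (gs 0) dvd [:x:] - (\<Sum>d<?m. smult (fps_to_fls (u d)) (local_gen 0 d))"
    using assms integral_mod_factor_iff[OF s] s unfolding integral_mod_iff by blast
  define w where "w d = (if d = 0 then x else 0) - fps_to_fls (u d)" for d
  have "(\<Sum>d<?m. smult (if d = 0 then x else 0) (local_gen 0 d)) =
      (\<Sum>d<?m. if d = 0 then [:x:] else 0)"
    by (intro sum.cong) (auto simp: local_gen_0[OF s])
  also have "\<dots> = [:x:]" using m by simp
  finally have eq: "[:x:] - (\<Sum>d<?m. smult (fps_to_fls (u d)) (local_gen 0 d)) =
      (\<Sum>d<?m. smult (w d) (local_gen 0 d))"
    by (simp add: w_def smult_diff_left sum_subtractf)
  have "degree (\<Sum>d<?m. smult (w d) (local_gen 0 d)) < ?m"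
    by (rule degree_combination_less) (use local_gen_degree[OF s] m in auto)
  then have "(\<Sum>d<?m. smult (w d) (local_gen 0 d)) = 0"
    using u dvd_imp_degree_le[of "lift_poly (gs 0)"] unfolding eq by fastforce
  then have "w 0 = 0"
    using triangular_combination_zero[of ?m "local_gen 0" w 0] local_gen_degree[OF s] m by blast
  then show ?thesis by (simp add: w_def)
qed

lemma bezout_lift:
  "i < s \<Longrightarrow> lift_poly (a i) * lift_poly (gs i) + lift_poly (b i) * lift_poly (h i) = [:fls_X ^ c i:]"
  using arg_cong[OF bezout[of i], of lift_poly] by (simp add: lift_poly_arith fps_to_fls_power)

text \<open>
  The Bezout relations make each factor coprime to the product of the others over \<open>K((X))\<close>, where
  \<open>X^c\<close> is invertible. Factors are therefore split off one at a time.
\<close>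
lemma dvd_of_factors_dvd:
  assumes "\<And>i. i < s \<Longrightarrow> lift_poly (gs i) dvd f"
  shows "lift_poly g dvd f"
proof -
  have "lift_poly (\<Prod>i\<in>I. gs i) dvd f" if "finite I" "I \<subseteq> {..<s}" for I
    using that
  proof (induction I)
    case (insert i I)
    then have i: "i < s" by auto
    obtain q where q: "f = lift_poly (\<Prod>i\<in>I. gs i) * q"
      using insert.IH insert.prems by (auto simp: dvd_def)
    have "(\<Prod>i\<in>I. gs i) dvd h i"
      unfolding h_eq[OF i] using insert by (intro prod_dvd_prod_subset) auto
    then obtain r where r: "h i = (\<Prod>i\<in>I. gs i) * r" by (rule dvdE)
    have "lift_poly (h i) * q = lift_poly r * f"
      unfolding r q by (simp add: lift_poly_arith ac_simps)
    then have hq: "lift_poly (gs i) dvd lift_poly (h i) * q"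
      using assms[OF i] by simp
    have "smult (fls_X ^ c i) q =
        (lift_poly (a i) * lift_poly (gs i) + lift_poly (b i) * lift_poly (h i)) * q"
      unfolding bezout_lift[OF i] by simp
    also have "\<dots> = lift_poly (gs i) * (lift_poly (a i) * q) + lift_poly (b i) * (lift_poly (h i) * q)"
      by (simp add: algebra_simps)
    finally have "lift_poly (gs i) dvd smult (fls_X ^ c i) q"
      using hq by simp
    then have "lift_poly (gs i) dvd q"
      by (simp add: dvd_smult_iff)
    then have "lift_poly (gs i) * lift_poly (\<Prod>i\<in>I. gs i) dvd q * lift_poly (\<Prod>i\<in>I. gs i)"
      by (rule mult_dvd_mono) simp
    then show ?case
      using insert by (simp add: q lift_poly_arith mult.commute)
  qed simp
  then show ?thesis unfolding g_eq by blast
qed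

text \<open>
  Modulo \<open>g\<^sub>i\<close> the Bezout relation says \<open>b\<^sub>i h\<^sub>i = X^c\<^sub>i\<close>.
\<close>
lemma glued_gen_cong:
  assumes i: "i < s"
  shows "lift_poly (gs i) dvd glued_gen i d - local_gen i d"
proof -
  let ?x = "fls_X powi (int (c i) + e i d) :: 'a fls"
  have "local_gen i d = smult (1 / ?x) (smult (fls_X ^ c i) (lift_poly (p i d)))"
    unfolding local_gen_def frac_X_def smult_smult
    by (subst inverse_power_int_shift[of _ "e i d" "c i"]) simp_all
  also have "smult (fls_X ^ c i) (lift_poly (p i d)) =
     (lift_poly (a i) * lift_poly (gs i) + lift_poly (b i) * lift_poly (h i)) * lift_poly (p i d)"
    unfolding bezout_lift[OF i] by simp
  finally have "glued_gen i d - local_gen i d =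
      smult (1 / ?x) (lift_poly (b i) * lift_poly (h i) * lift_poly (p i d) -
        (lift_poly (a i) * lift_poly (gs i) + lift_poly (b i) * lift_poly (h i)) * lift_poly (p i d))"
    unfolding glued_gen_def frac_X_def lift_poly_arith smult_diff_right by (simp only:)
  also have "\<dots> = smult (1 / ?x) (lift_poly (gs i) * (- (lift_poly (a i) * lift_poly (p i d))))"
    by (rule arg_cong[where f = "smult (1 / ?x)"]) (simp add: algebra_simps)
  finally show ?thesis by (simp only: dvd_smult dvd_triv_left)
qed

lemma glued_gen_dvd:
  assumes "i < s" "j < s" "j \<noteq> i"
  shows "lift_poly (gs j) dvd glued_gen i d"
proof -
  have "gs j dvd h i"
    unfolding h_eq[OF assms(1)] using assms by (intro dvd_prodI) auto
  then have "lift_poly (gs j) dvd lift_poly (b i * h i * p i d)"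
    by (intro lift_poly_hom.hom_dvd) simp
  then show ?thesis unfolding glued_gen_def frac_X_def by (rule dvd_smult)
qed

lemma glued_gen_integral:
  assumes i: "i < s" and d: "d < degree (gs i)"
  shows "integral_mod g (glued_gen i d)"
  unfolding integral_mod_iff
proof (intro allI impI)
  fix j assume j: "j < s"
  show "integral_mod (gs j) (glued_gen i d)"
  proof (cases "j = i")
    case True
    have "(\<Sum>k<degree (gs i). smult (fps_to_fls (if k = d then 1 else 0)) (local_gen i k)) =
        (\<Sum>k<degree (gs i). if k = d then local_gen i k else 0)"
      by (intro sum.cong) auto
    then have "integral_mod (gs i) (local_gen i d)"
      unfolding integral_mod_factor_iff[OF i]
      using d by (intro exI[of _ "\<lambda>k. if k = d then 1 else 0"]) simp
    then show ?thesis
      using integral_mod_cong[OF glued_gen_cong[OF i]] True by blast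
  next
    case False
    have "integral_mod (gs j) 0"
      using integral_mod_lift[of "gs j" 0] by simp
    then show ?thesis
      using integral_mod_cong[of "gs j" "glued_gen i d" 0] glued_gen_dvd[OF i j False] by simp
  qed
qed

text \<open>
  Expand \<open>f\<close> modulo every factor in the given basis; the same coefficients work for the glued
  generators, by comparing both sides modulo each factor.
\<close>
lemma glued_gen_generate:
  assumes "integral_mod g f"
  shows "\<exists>u. lift_poly g dvd f - (\<Sum>i<s. \<Sum>d<degree (gs i). smult (fps_to_fls (u i d)) (glued_gen i d))"
proof -
  have "\<forall>i. \<exists>u. i < s \<longrightarrow>
      lift_poly (gs i) dvd f - (\<Sum>d<degree (gs i). smult (fps_to_fls (u d)) (local_gen i d))"
    using assms integral_mod_factor_iff unfolding integral_mod_iff by blast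
  then obtain u where u: "\<And>i. i < s \<Longrightarrow>
      lift_poly (gs i) dvd f - (\<Sum>d<degree (gs i). smult (fps_to_fls (u i d)) (local_gen i d))"
    by metis
  let ?G = "\<lambda>i. \<Sum>d<degree (gs i). smult (fps_to_fls (u i d)) (glued_gen i d)"
  let ?L = "\<lambda>i. \<Sum>d<degree (gs i). smult (fps_to_fls (u i d)) (local_gen i d)"
  have "lift_poly g dvd f - (\<Sum>i<s. ?G i)"
  proof (rule dvd_of_factors_dvd)
    fix j assume j: "j < s"
    have "(\<Sum>i<s. ?G i) = ?G j + (\<Sum>i\<in>{..<s} - {j}. ?G i)"
      using j by (intro sum.remove) auto
    then have eq: "f - (\<Sum>i<s. ?G i) = (f - ?L j) - (?G j - ?L j) - (\<Sum>i\<in>{..<s} - {j}. ?G i)"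
      by simp
    have "?G j - ?L j = (\<Sum>d<degree (gs j). smult (fps_to_fls (u j d)) (glued_gen j d - local_gen j d))"
      by (simp add: sum_subtractf smult_diff_right)
    moreover have "lift_poly (gs j) dvd \<dots>"
      by (intro dvd_sum dvd_smult glued_gen_cong[OF j])
    ultimately have "lift_poly (gs j) dvd ?G j - ?L j" by simp
    moreover have "lift_poly (gs j) dvd (\<Sum>i\<in>{..<s} - {j}. ?G i)"
      using j by (intro dvd_sum dvd_smult glued_gen_dvd) auto
    ultimately show "lift_poly (gs j) dvd f - (\<Sum>i<s. ?G i)"
      unfolding eq using u[OF j] dvd_diff by blast
  qed
  then show ?thesis by blast
qed

text \<open>
  Modulo \<open>g\<^sub>i\<close> the glued generators that belong to \<open>i\<close> have different degrees and are nonzero, whereas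
  those of the other factors vanish.
\<close>
lemma glued_gen_inj: "inj_on (\<lambda>(i, d). glued_gen i d) (SIGMA i:{..<s}. {..<degree (gs i)})"
proof (rule inj_onI, clarsimp)
  fix i d j k assume i: "i < s" "d < degree (gs i)" and j: "j < s" "k < degree (gs j)"
    and eq: "glued_gen i d = glued_gen j k"
  have small: "f = 0" if "lift_poly (gs i) dvd f" "degree f < degree (gs i)" for f
  proof (rule ccontr)
    assume "f \<noteq> 0"
    then show False using dvd_imp_degree_le[OF that(1)] that(2) by simp
  qed
  have i_dvd: "lift_poly (gs i) dvd glued_gen i d - local_gen i d" by (rule glued_gen_cong[OF i(1)])
  show "i = j \<and> d = k"
  proof (cases "i = j")
    case True
    then have eq': "glued_gen i d = glued_gen i k" using eq by simp
    from dvd_diff[OF glued_gen_cong[OF i(1), of k] i_dvd]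
    have "lift_poly (gs i) dvd local_gen i d - local_gen i k"
      unfolding eq' by simp
    moreover have "degree (local_gen i d - local_gen i k) < degree (gs i)"
    proof (rule degree_diff_less)
      show "degree (local_gen i d) < degree (gs i)" using local_gen_degree[OF i] i(2) by simp
      show "degree (local_gen i k) < degree (gs i)"
        unfolding True using local_gen_degree[OF j] j(2) by simp
    qed
    ultimately have "local_gen i d - local_gen i k = 0" by (rule small)
    then have "degree (local_gen i d) = degree (local_gen i k)" by simp
    moreover have "degree (local_gen i k) = k" unfolding True using local_gen_degree[OF j] by blast
    ultimately show ?thesis using local_gen_degree[OF i] True by simp
  next
    case False
    have "lift_poly (gs i) dvd glued_gen i d"
      unfolding eq using glued_gen_dvd[OF j(1) i(1)] False by simp
    then have "lift_poly (gs i) dvd glued_gen i d - (glued_gen i d - local_gen i d)"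
      using i_dvd by (rule dvd_diff)
    then have "lift_poly (gs i) dvd local_gen i d" by simp
    moreover have "degree (local_gen i d) < degree (gs i)" using local_gen_degree[OF i] i(2) by simp
    ultimately have "local_gen i d = 0" by (rule small)
    then show ?thesis using local_gen_degree[OF i] by simp
  qed
qed

lemma degree_g_eq: "degree g = (\<Sum>i<s. degree (gs i))"
  unfolding g_eq using monic by (intro degree_prod_eq_sum_degree) force

text \<open>
  The count of generators is what makes the coefficient matrix square.
\<close>
lemma
  assumes "distinct cs" and set: "set cs = (\<lambda>(i, d). glued_gen i d) ` (SIGMA i:{..<s}. {..<degree (gs i)})"
  shows length_glued_list: "length cs = degree g"
    and glued_list_generate: "integral_mod g f \<Longrightarrow>
      \<exists>v. lift_poly g dvd f - (\<Sum>k<degree g. smult (fps_to_fls (v k)) (cs ! k))"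
proof -
  let ?I = "SIGMA i:{..<s}. {..<degree (gs i)}"
  have "length cs = card ?I"
    using distinct_card[OF assms(1)] card_image[OF glued_gen_inj] by (simp add: set)
  then show len: "length cs = degree g" by (simp add: degree_g_eq)
  assume "integral_mod g f"
  then obtain u where u: "lift_poly g dvd
      f - (\<Sum>i<s. \<Sum>d<degree (gs i). smult (fps_to_fls (u i d)) (glued_gen i d))"
    using glued_gen_generate by blast
  define w where "w z = case_prod u (inv_into ?I (\<lambda>(i, d). glued_gen i d) z)" for z
  have w: "w (glued_gen i d) = u i d" if "i < s" "d < degree (gs i)" for i d
    using inv_into_f_f[OF glued_gen_inj, of "(i, d)"] that by (simp add: w_def)
  have "(\<Sum>i<s. \<Sum>d<degree (gs i). smult (fps_to_fls (u i d)) (glued_gen i d)) =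
      (\<Sum>(i, d)\<in>?I. smult (fps_to_fls (w (glued_gen i d))) (glued_gen i d))"
    by (subst sum.Sigma) (auto intro!: sum.cong simp: w)
  also have "\<dots> = (\<Sum>z\<in>set cs. smult (fps_to_fls (w z)) z)"
    unfolding set by (subst sum.reindex[OF glued_gen_inj]) (auto intro!: sum.cong)
  also have "\<dots> = (\<Sum>k<degree g. smult (fps_to_fls (w (cs ! k))) (cs ! k))"
    by (rule sum.reindex_bij_betw[symmetric]) (rule bij_betw_nth[OF assms(1)], simp_all add: len)
  finally show "\<exists>v. lift_poly g dvd f - (\<Sum>k<degree g. smult (fps_to_fls (v k)) (cs ! k))"
    using u by (intro exI[of _ "\<lambda>k. w (cs ! k)"]) simp
qed

end

section \<open>Lattices of polynomials stable under multiplication by \<open>Y\<close>\<close>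

lemma fps_decomp:
  fixes c :: "'a::field fps"
  assumes "c \<noteq> 0"
  obtains u v where "c = fps_X ^ subdegree c * u" "u * v = 1"
proof
  show "c = fps_X ^ subdegree c * unit_factor c"
    using subdegree_decompose[of c] by (simp add: mult.commute)
  show "unit_factor c * inverse (unit_factor c) = 1"
    using assms by (intro inverse_mult_eq_1') (simp add: nth_subdegree_nonzero)
qed

lemma fps_X_power_nonzero: "fps_X ^ a \<noteq> (0 :: 'a::field fps)"
  by simp

lemma fps_X_power_dvd_mult_iff:
  fixes c :: "'a::field fps"
  assumes "a + b = k"
  shows "fps_X ^ k dvd fps_X ^ a * c \<longleftrightarrow> fps_X ^ b dvd c"
proof -
  have "fps_X ^ k = fps_X ^ a * (fps_X ^ b :: 'a fps)"
    using assms by (simp add: power_add[symmetric])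
  then show ?thesis by (simp only: dvd_mult_cancel_left fps_X_power_nonzero simp_thms)
qed

text \<open>
  A \<open>K[[X]]\<close>-module of polynomials of degree less than \<open>m\<close>, closed under multiplication by \<open>Y\<close> as far as
  the degree permits. It models \<open>X^D\<close> times a ring of integral elements: \<open>X^D\<close> stands for the unit of
  that ring, and its constants are the multiples of \<open>X^D\<close>.
\<close>
locale stable_lattice =
  fixes \<Lambda> :: "'a::field fps poly set" and m D :: nat
  assumes degree_less: "q \<in> \<Lambda> \<Longrightarrow> degree q < m"
    and add: "q \<in> \<Lambda> \<Longrightarrow> q' \<in> \<Lambda> \<Longrightarrow> q + q' \<in> \<Lambda>"
    and smult: "q \<in> \<Lambda> \<Longrightarrow> smult a q \<in> \<Lambda>"
    and shift: "q \<in> \<Lambda> \<Longrightarrow> Suc (degree q) < m \<Longrightarrow> pCons 0 q \<in> \<Lambda>"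
    and const_mem: "[:fps_X ^ D:] \<in> \<Lambda>"
    and const_dvd: "[:a:] \<in> \<Lambda> \<Longrightarrow> fps_X ^ D dvd a"
begin

lemma diff: "q \<in> \<Lambda> \<Longrightarrow> q' \<in> \<Lambda> \<Longrightarrow> q - q' \<in> \<Lambda>"
  using add[of q "smult (-1) q'"] smult[of q' "-1"] by simp

lemma sum: "(\<And>i. i \<in> I \<Longrightarrow> q i \<in> \<Lambda>) \<Longrightarrow> sum q I \<in> \<Lambda>"
proof (induction I rule: infinite_finite_induct)
  case (insert i I)
  then show ?case by (simp add: add)
qed (use smult[OF const_mem, of 0] in simp_all)

text \<open>
  Leading coefficients need only be considered up to units, that is, as powers of \<open>X\<close>.
\<close>
definition attains :: "nat \<Rightarrow> nat \<Rightarrow> bool" where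
  "attains d k \<longleftrightarrow> (\<exists>q\<in>\<Lambda>. degree q = d \<and> coeff q d = fps_X ^ k)"

definition lead_exp :: "nat \<Rightarrow> nat" where
  "lead_exp d = (LEAST k. attains d k)"

lemma attains_Suc: "attains d k \<Longrightarrow> Suc d < m \<Longrightarrow> attains (Suc d) k"
proof -
  assume "attains d k" "Suc d < m"
  then obtain q where q: "q \<in> \<Lambda>" "degree q = d" "coeff q d = fps_X ^ k"
    by (auto simp: attains_def)
  then have "q \<noteq> 0" by auto
  with q show ?thesis
    using shift[of q] \<open>Suc d < m\<close> unfolding attains_def by (intro bexI[of _ "pCons 0 q"]) auto
qed

lemma attains_denom: "d < m \<Longrightarrow> attains d D"
proof (induction d)
  case 0
  then show ?case using const_mem by (auto simp: attains_def intro!: bexI[of _ "[:fps_X ^ D:]"])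
qed (use attains_Suc in auto)

lemma attains_lead_exp: "d < m \<Longrightarrow> attains d (lead_exp d)"
  unfolding lead_exp_def by (rule LeastI) (rule attains_denom)

lemma lead_exp_le: "attains d k \<Longrightarrow> lead_exp d \<le> k"
  unfolding lead_exp_def by (rule Least_le)

lemma lead_exp_Suc: "Suc d < m \<Longrightarrow> lead_exp (Suc d) \<le> lead_exp d"
  using attains_Suc attains_lead_exp lead_exp_le by simp

lemma lead_exp_le_denom: "d < m \<Longrightarrow> lead_exp d \<le> D"
  by (rule lead_exp_le) (rule attains_denom)

lemma lead_exp_dvd:
  assumes q: "q \<in> \<Lambda>" "degree q \<le> d"
  shows "fps_X ^ lead_exp d dvd coeff q d"
proof (cases "coeff q d = 0")
  case False
  then have deg: "degree q = d" using q(2) by (simp add: le_antisym le_degree)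
  obtain u v where uv: "coeff q d = fps_X ^ subdegree (coeff q d) * u" "u * v = 1"
    using fps_decomp[OF False] .
  have "v \<noteq> 0" using uv(2) by auto
  then have "degree (smult v q) = d" using deg by simp
  moreover have "coeff (smult v q) d = fps_X ^ subdegree (coeff q d)"
  proof -
    have "coeff (smult v q) d = v * (fps_X ^ subdegree (coeff q d) * u)"
      using uv(1) by (metis coeff_smult)
    also have "\<dots> = fps_X ^ subdegree (coeff q d) * (u * v)"
      by (simp only: ac_simps)
    finally show ?thesis by (simp only: uv(2) mult_1_right)
  qed
  ultimately have "attains d (subdegree (coeff q d))"
    using smult[OF q(1), of v] unfolding attains_def by blast
  then have "fps_X ^ lead_exp d dvd (fps_X ^ subdegree (coeff q d) :: 'a fps)"
    by (intro le_imp_power_dvd lead_exp_le)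
  then show ?thesis by (subst uv(1)) (rule dvd_mult2)
qed simp

lemma lead_exp_0: "0 < m \<Longrightarrow> lead_exp 0 = D"
proof -
  assume "0 < m"
  then obtain q where q: "q \<in> \<Lambda>" "degree q = 0" "coeff q 0 = fps_X ^ lead_exp 0"
    using attains_lead_exp by (auto simp: attains_def)
  then have "fps_X ^ D dvd (fps_X ^ lead_exp 0 :: 'a fps)"
    using const_dvd[of "coeff q 0"] by (metis degree_eq_zeroE coeff_pCons_0)
  then have "D \<le> lead_exp 0"
    by (simp add: fps_dvd_iff)
  with lead_exp_le_denom \<open>0 < m\<close> show ?thesis by force
qed

text \<open>
  The reason why the basis is monic in lowest terms. Let \<open>\<mu>\<close> denote \<open>lead_exp\<close>, and let \<open>r\<close> have degree
  \<open>d\<close> and leading coefficient \<open>X^\<mu>(d)\<close>. For \<open>q\<close> of degree \<open>d + 1\<close> with leading coefficient \<open>w X^\<mu>(d+1)\<close>, the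
  element \<open>X^(\<mu>(d) - \<mu>(d+1)) q - w Y r\<close> has degree at most \<open>d\<close>. By induction it is divisible by
  \<open>X^\<mu>(d)\<close>, and so is \<open>r\<close>; cancelling gives that \<open>X^\<mu>(d+1)\<close> divides \<open>q\<close>. Multiplication by \<open>Y\<close> enters
  twice: in \<open>Y r\<close>, and in \<open>\<mu>(d+1) \<le> \<mu>(d)\<close>.
\<close>
theorem lead_exp_dvd_coeff:
  assumes "q \<in> \<Lambda>" "degree q \<le> d" "d < m"
  shows "fps_X ^ lead_exp d dvd coeff q j"
  using assms
proof (induction d arbitrary: q j)
  case 0
  then have "q = [:coeff q 0:]" by (auto elim: degree_eq_zeroE)
  then have "fps_X ^ D dvd coeff q 0" using const_dvd 0 by metis
  then show ?case using 0 lead_exp_0 by (cases j) (auto simp: coeff_eq_0)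
next
  case (Suc d)
  obtain w where w: "coeff q (Suc d) = fps_X ^ lead_exp (Suc d) * w"
    using lead_exp_dvd[of q "Suc d"] Suc.prems by (auto elim: dvdE)
  obtain r where r: "r \<in> \<Lambda>" "degree r = d" "coeff r d = fps_X ^ lead_exp d"
    using attains_lead_exp[of d] Suc.prems by (auto simp: attains_def)
  define k where "k = lead_exp d - lead_exp (Suc d)"
  have k: "k + lead_exp (Suc d) = lead_exp d"
    using lead_exp_Suc Suc.prems by (simp add: k_def)
  define t where "t = smult (fps_X ^ k) q - smult w (pCons 0 r)"
  have t: "t \<in> \<Lambda>"
    unfolding t_def using shift[OF r(1)] r(2) Suc.prems by (intro diff smult) auto
  have "degree t \<le> d"
  proof (rule degree_le, intro allI impI)
    fix i assume i: "d < i"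
    show "coeff t i = 0"
    proof (cases "i = Suc d")
      case True
      then show ?thesis using r w k
        by (simp add: t_def mult.assoc[symmetric] power_add[symmetric])
    next
      case False
      then show ?thesis using i Suc.prems r
        by (auto simp: t_def coeff_pCons coeff_eq_0 split: nat.split)
    qed
  qed
  then have "fps_X ^ lead_exp d dvd coeff t j"
    using Suc.IH[OF t] Suc.prems by simp
  moreover have "fps_X ^ lead_exp d dvd w * coeff (pCons 0 r) j"
    using Suc.IH[OF r(1)] r(2) Suc.prems by (auto simp: coeff_pCons split: nat.split)
  ultimately have "fps_X ^ lead_exp d dvd coeff t j + w * coeff (pCons 0 r) j"
    by (rule dvd_add)
  then have "fps_X ^ lead_exp d dvd fps_X ^ k * coeff q j"
    by (simp add: t_def del: smult_pCons)
  then show ?case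
    by (simp only: fps_X_power_dvd_mult_iff[OF k])
qed

text \<open>
  Coefficients are reduced from the top downwards, so that subtracting a multiple of an element of
  degree \<open>n\<close> does not disturb the coefficients that are already reduced.
\<close>
lemma truncate_below:
  assumes "q \<in> \<Lambda>" "n \<le> m"
  shows "\<exists>q'\<in>\<Lambda>. (\<forall>j\<ge>n. coeff q' j = coeff q j) \<and>
    (\<forall>j<n. coeff q' j = fps_cutoff (lead_exp j) (coeff q' j))"
  using assms
proof (induction n arbitrary: q)
  case (Suc n)
  obtain r where r: "r \<in> \<Lambda>" "degree r = n" "coeff r n = fps_X ^ lead_exp n"
    using attains_lead_exp[of n] Suc.prems by (auto simp: attains_def)
  define q1 where "q1 = q - smult (fps_shift (lead_exp n) (coeff q n)) r"
  have q1: "q1 \<in> \<Lambda>" unfolding q1_def using Suc.prems r by (intro diff smult) auto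
  have "coeff q1 n = fps_cutoff (lead_exp n) (coeff q n)"
    using r(3) fps_shift_cutoff[of "lead_exp n" "coeff q n"] by (simp add: q1_def algebra_simps)
  then have n: "coeff q1 n = fps_cutoff (lead_exp n) (coeff q1 n)"
    by (simp add: fps_eq_iff)
  have hi: "coeff q1 j = coeff q j" if "j > n" for j
    using that r by (simp add: q1_def coeff_eq_0)
  obtain q' where q': "q' \<in> \<Lambda>" "\<forall>j\<ge>n. coeff q' j = coeff q1 j"
    "\<forall>j<n. coeff q' j = fps_cutoff (lead_exp j) (coeff q' j)"
    using Suc.IH[OF q1] Suc.prems by auto
  then show ?case
    using n hi by (intro bexI[of _ q']) (auto simp: less_Suc_eq)
qed auto

lemma triangular_generates:
  assumes b: "\<And>d. d < m \<Longrightarrow> b d \<in> \<Lambda> \<and> degree (b d) = d \<and> coeff (b d) d = fps_X ^ lead_exp d"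
    and "q \<in> \<Lambda>" "n \<le> m" "\<And>j. j \<ge> n \<Longrightarrow> coeff q j = 0"
  shows "\<exists>u. q = (\<Sum>d<m. smult (u d) (b d))"
  using assms(2-)
proof (induction n arbitrary: q)
  case 0
  then have "q = 0" by (simp add: poly_eq_iff)
  then show ?case by (intro exI[of _ "\<lambda>_. 0"]) simp
next
  case (Suc n)
  then have n: "n < m" by simp
  have "degree q \<le> n" using Suc.prems by (intro degree_le) auto
  then obtain w where w: "coeff q n = fps_X ^ lead_exp n * w"
    using lead_exp_dvd[of q n] Suc.prems by (auto elim: dvdE)
  have "q - smult w (b n) \<in> \<Lambda>"
    using Suc.prems b[OF n] by (intro diff smult) auto
  moreover have "coeff (q - smult w (b n)) j = 0" if "j \<ge> n" for j
    using Suc.prems b[OF n] w that by (cases "j = n") (auto simp: coeff_eq_0)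
  ultimately obtain u where u: "q - smult w (b n) = (\<Sum>d<m. smult (u d) (b d))"
    using Suc.IH n by (meson less_imp_le)
  have "(\<Sum>d<m. smult (u d + (if d = n then w else 0)) (b d)) =
      (\<Sum>d<m. smult (u d) (b d)) + (\<Sum>d<m. if d = n then smult w (b d) else 0)"
    unfolding sum.distrib[symmetric] by (intro sum.cong) (auto simp: smult_add_left)
  also have "\<dots> = q" unfolding u[symmetric] using n by simp
  finally have "q = (\<Sum>d<m. smult (u d + (if d = n then w else 0)) (b d))" by (rule sym)
  then show ?case by (rule exI[of _ "\<lambda>d. u d + (if d = n then w else 0)"])
qed

theorem reduced_triangular_basis:
  obtains b where
    "\<And>d. d < m \<Longrightarrow> b d \<in> \<Lambda> \<and> degree (b d) = d \<and> coeff (b d) d = fps_X ^ lead_exp d"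
    "\<And>d j. d < m \<Longrightarrow> j < d \<Longrightarrow> coeff (b d) j = fps_cutoff (lead_exp j) (coeff (b d) j)"
    "\<And>q. q \<in> \<Lambda> \<Longrightarrow> \<exists>u. q = (\<Sum>d<m. smult (u d) (b d))"
proof -
  have "\<exists>q. q \<in> \<Lambda> \<and> degree q = d \<and> coeff q d = fps_X ^ lead_exp d \<and>
      (\<forall>j<d. coeff q j = fps_cutoff (lead_exp j) (coeff q j))" if d: "d < m" for d
  proof -
    obtain r where r: "r \<in> \<Lambda>" "degree r = d" "coeff r d = fps_X ^ lead_exp d"
      using attains_lead_exp[OF d] by (auto simp: attains_def)
    obtain q where q: "q \<in> \<Lambda>" "\<forall>j\<ge>d. coeff q j = coeff r j"
      "\<forall>j<d. coeff q j = fps_cutoff (lead_exp j) (coeff q j)"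
      using truncate_below[OF r(1)] d less_imp_le by metis
    have "degree q = d"
      by (rule antisym[OF degree_le le_degree]) (use q(2) r in \<open>auto simp: coeff_eq_0\<close>)
    then show ?thesis using q r(3) by (intro exI[of _ q]) simp_all
  qed
  then obtain b where b: "\<And>d. d < m \<Longrightarrow> b d \<in> \<Lambda> \<and> degree (b d) = d \<and>
      coeff (b d) d = fps_X ^ lead_exp d \<and>
      (\<forall>j<d. coeff (b d) j = fps_cutoff (lead_exp j) (coeff (b d) j))"
    by metis
  then have b': "\<And>d. d < m \<Longrightarrow> b d \<in> \<Lambda> \<and> degree (b d) = d \<and> coeff (b d) d = fps_X ^ lead_exp d"
    by blast
  have "\<exists>u. q = (\<Sum>d<m. smult (u d) (b d))" if "q \<in> \<Lambda>" for q
    by (rule triangular_generates[OF b' that order.refl])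
       (use degree_less[OF that] in \<open>auto simp: coeff_eq_0\<close>)
  then show ?thesis using that[of b] b by blast
qed

end

section \<open>Hermite normal forms over \<open>K[[X]]\<close>\<close>

text \<open>
  A combination of the rows of a Hermite matrix whose entries are reduced modulo the diagonal must be
  trivial: in column \<open>k\<close> only the term \<open>w\<^sub>k X^\<nu>\<^sub>k\<close> is left once the earlier coefficients vanish, and a
  polynomial of degree less than \<open>\<nu>\<^sub>k\<close> is divisible by \<open>X^\<nu>\<^sub>k\<close> only if it is zero. This gives uniqueness
  of the normal form as well as the cancellation of \<open>H\<close> in \<open>U V H = H\<close>.
\<close>
lemma small_combination_zero:
  fixes h :: "nat \<Rightarrow> nat \<Rightarrow> 'a::field poly" and w :: "nat \<Rightarrow> 'a fps"
  assumes tri: "\<And>i j. i < n \<Longrightarrow> j < m \<Longrightarrow> j < i \<Longrightarrow> h i j = 0"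
    and diag: "\<And>i. i < m \<Longrightarrow> h i i = monom 1 (\<nu> i)"
    and "m \<le> n" "K \<le> m"
    and small: "\<And>j. j < K \<Longrightarrow> \<exists>r. (\<Sum>k<n. w k * fps_of_poly (h k j)) = fps_of_poly r \<and>
        (r = 0 \<or> degree r < \<nu> j)"
    and "k < K"
  shows "w k = 0"
  using \<open>k < K\<close>
proof (induction k rule: less_induct)
  case (less k)
  obtain r where r: "(\<Sum>l<n. w l * fps_of_poly (h l k)) = fps_of_poly r" "r = 0 \<or> degree r < \<nu> k"
    using small[OF less.prems] by blast
  have "(\<Sum>l<n. w l * fps_of_poly (h l k)) = (\<Sum>l<n. if l = k then w k * fps_of_poly (h k k) else 0)"
  proof (rule sum.cong)
    fix l assume l: "l \<in> {..<n}"
    consider "l < k" | "l = k" | "l > k" by linarith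
    then show "w l * fps_of_poly (h l k) = (if l = k then w k * fps_of_poly (h k k) else 0)"
    proof cases
      case 1
      then show ?thesis using less by simp
    next
      case 3
      then have "h l k = 0" using tri[of l k] l less.prems assms(3,4) by simp
      then show ?thesis using 3 by simp
    qed simp
  qed simp
  also have "\<dots> = w k * fps_X ^ \<nu> k"
    using less.prems assms(3,4) diag[of k] by (simp add: fps_of_poly_monom')
  finally have eq: "w k * fps_X ^ \<nu> k = fps_of_poly r" using r(1) by simp
  show "w k = 0"
  proof (rule fps_ext)
    fix i
    have "fps_nth (w k) i = fps_nth (w k * fps_X ^ \<nu> k) (i + \<nu> k)"
      by (simp add: fps_X_power_mult_right_nth)
    also have "\<dots> = coeff r (i + \<nu> k)" by (simp add: eq)
    also have "\<dots> = 0" using r(2) by (auto intro: coeff_eq_0)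
    finally show "fps_nth (w k) i = fps_nth 0 i" by simp
  qed
qed

lemma mult_mat_entry:
  assumes "A \<in> carrier_mat n k" "B \<in> carrier_mat k m" "i < n" "j < m"
  shows "(A * B) $$ (i, j) = (\<Sum>l<k. A $$ (i, l) * B $$ (l, j))"
  using assms by (auto simp: scalar_prod_def lessThan_atLeast0)

lemma is_hermite_form_dims:
  assumes "is_hermite_form M H"
  shows "dim_row H = dim_row M" "dim_col H = dim_col M" "dim_col M \<le> dim_row M"
proof -
  have "dim_row H = dim_row M \<and> dim_col H = dim_col M \<and> dim_col M \<le> dim_row M"
    using assms unfolding is_hermite_form_def by (elim conjE) (intro conjI)
  then show "dim_row H = dim_row M" "dim_col H = dim_col M" "dim_col M \<le> dim_row M"
    by simp_all
qed

lemma is_hermite_form_lower: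
  assumes "is_hermite_form M H" "i < dim_row M" "j < dim_col M" "j < i"
  shows "H $$ (i, j) = 0"
proof -
  have "\<forall>i<dim_row H. \<forall>j<dim_col H. j < i \<longrightarrow> H $$ (i, j) = 0"
    using assms(1) unfolding is_hermite_form_def by (elim conjE)
  then show ?thesis using assms is_hermite_form_dims[OF assms(1)] by simp
qed

lemma is_hermite_form_transform:
  assumes "is_hermite_form M H"
  obtains U where "U \<in> carrier_mat (dim_row M) (dim_row M)" "invertible_mat U"
    "U * M = map_mat fps_of_poly H"
  using assms unfolding is_hermite_form_def by (elim conjE bexE) (rule that)

lemma is_hermite_form_exponents:
  assumes "is_hermite_form M H"
  obtains \<nu> where "\<And>i. i < dim_col M \<Longrightarrow> H $$ (i, i) = monom 1 (\<nu> i)"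
    "\<And>i j. j < dim_col M \<Longrightarrow> i < j \<Longrightarrow> H $$ (i, j) = 0 \<or> degree (H $$ (i, j)) < \<nu> j"
proof -
  have dim: "dim_col H = dim_col M" by (rule is_hermite_form_dims(2)[OF assms])
  have "\<exists>\<nu> :: nat \<Rightarrow> nat. (\<forall>i<dim_col H. H $$ (i, i) = monom 1 (\<nu> i)) \<and>
      (\<forall>j<dim_col H. \<forall>i<j. H $$ (i, j) = 0 \<or> degree (H $$ (i, j)) < \<nu> j)"
    using assms unfolding is_hermite_form_def by (elim conjE)
  then obtain \<nu> where "\<forall>i<dim_col M. H $$ (i, i) = monom 1 (\<nu> i)"
    "\<forall>j<dim_col M. \<forall>i<j. H $$ (i, j) = 0 \<or> degree (H $$ (i, j)) < \<nu> j"
    unfolding dim by (elim exE conjE) (rule that)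
  then show ?thesis by (intro that[of \<nu>]) iprover+
qed

text \<open>
  Two normal forms of the same matrix span the same row module.
\<close>
lemma hermite_form_transition:
  assumes "is_hermite_form M H" and "is_hermite_form M H'"
  obtains W where "\<And>i j. i < dim_row M \<Longrightarrow> j < dim_col M \<Longrightarrow>
    fps_of_poly (H' $$ (i, j)) = (\<Sum>k<dim_row M. W i k * fps_of_poly (H $$ (k, j)))"
proof -
  define n m where "n = dim_row M" and "m = dim_col M"
  have M: "M \<in> carrier_mat n m" by (rule carrier_matI) (simp_all only: n_def m_def)
  have dims: "dim_row H = n" "dim_col H = m" "dim_row H' = n" "dim_col H' = m"
    by (simp_all only: n_def m_def is_hermite_form_dims[OF assms(1)] is_hermite_form_dims[OF assms(2)])
  obtain U where U: "U \<in> carrier_mat n n" "invertible_mat U" "U * M = map_mat fps_of_poly H"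
    unfolding n_def by (rule is_hermite_form_transform[OF assms(1)]) (rule that[unfolded n_def])
  obtain U' where U': "U' \<in> carrier_mat n n" "U' * M = map_mat fps_of_poly H'"
    unfolding n_def by (rule is_hermite_form_transform[OF assms(2)]) (rule that[unfolded n_def])
  obtain V where V: "U * V = 1\<^sub>m n" "V * U = 1\<^sub>m (dim_row V)"
    using U(1,2) unfolding invertible_mat_def inverts_mat_def by auto
  have V_car: "V \<in> carrier_mat n n"
    using arg_cong[OF V(1), of dim_col] arg_cong[OF V(2), of dim_col] U(1) by auto
  have M_eq: "M = V * map_mat fps_of_poly H"
  proof -
    have "V * (U * M) = (V * U) * M"
      by (rule assoc_mult_mat[OF V_car U(1) M, symmetric])
    also have "\<dots> = 1\<^sub>m n * M" using V(2) V_car by (simp only: carrier_matD)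
    also have "\<dots> = M" by (rule left_mult_one_mat[OF M])
    finally show ?thesis unfolding U(3) by (rule sym)
  qed
  define W where "W = U' * V"
  have W: "W \<in> carrier_mat n n" using U' V_car by (simp add: W_def)
  have Hc: "map_mat fps_of_poly H \<in> carrier_mat n m" using dims by auto
  have "map_mat fps_of_poly H' = U' * (V * map_mat fps_of_poly H)"
    unfolding U'(2)[symmetric] by (simp only: M_eq[symmetric])
  also have "\<dots> = W * map_mat fps_of_poly H"
    unfolding W_def by (rule assoc_mult_mat[OF U'(1) V_car Hc, symmetric])
  finally have eq: "map_mat fps_of_poly H' = W * map_mat fps_of_poly H" .
  have "fps_of_poly (H' $$ (i, j)) = (\<Sum>k<n. W $$ (i, k) * fps_of_poly (H $$ (k, j)))"
    if "i < n" "j < m" for i j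
  proof -
    have "map_mat fps_of_poly H' $$ (i, j) = (\<Sum>k<n. W $$ (i, k) * map_mat fps_of_poly H $$ (k, j))"
      unfolding eq by (rule mult_mat_entry[OF W Hc that])
    moreover have "(\<Sum>k<n. W $$ (i, k) * map_mat fps_of_poly H $$ (k, j)) =
        (\<Sum>k<n. W $$ (i, k) * fps_of_poly (H $$ (k, j)))"
      using that dims by (intro sum.cong) auto
    ultimately show ?thesis using that dims by simp
  qed
  then show ?thesis
    unfolding n_def m_def by (rule that)
qed

lemma hermite_form_diag_le:
  assumes H: "is_hermite_form M H" and H': "is_hermite_form M H'"
    and diag: "\<And>i. i < dim_col M \<Longrightarrow> H $$ (i, i) = monom 1 (\<nu> i)"
    and diag': "\<And>i. i < dim_col M \<Longrightarrow> H' $$ (i, i) = monom 1 (\<nu>' i)"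
    and i: "i < dim_col M"
  shows "\<nu> i \<le> \<nu>' i"
proof -
  have dims: "dim_row H = dim_row M" "dim_col H = dim_col M" "dim_row H' = dim_row M"
    "dim_col H' = dim_col M" "dim_col M \<le> dim_row M"
    using is_hermite_form_dims[OF H] is_hermite_form_dims[OF H'] by simp_all
  have tri: "H $$ (k, j) = 0" "H' $$ (k, j) = 0" if "k < dim_row M" "j < dim_col M" "j < k" for k j
    using is_hermite_form_lower[OF H that] is_hermite_form_lower[OF H' that] by simp_all
  obtain W where W: "\<And>i j. i < dim_row M \<Longrightarrow> j < dim_col M \<Longrightarrow>
      fps_of_poly (H' $$ (i, j)) = (\<Sum>k<dim_row M. W i k * fps_of_poly (H $$ (k, j)))"
    by (rule hermite_form_transition[OF H H']) (rule that)
  have W0: "W i k = 0" if "k < i" for k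
  proof (rule small_combination_zero[where h = "\<lambda>k j. H $$ (k, j)" and K = i
        and n = "dim_row M" and m = "dim_col M" and \<nu> = \<nu>])
    fix j assume j: "j < i"
    then have "(\<Sum>k<dim_row M. W i k * fps_of_poly (H $$ (k, j))) = fps_of_poly 0"
      using W[of i j] tri(2)[of i j] i dims by simp
    then show "\<exists>r. (\<Sum>k<dim_row M. W i k * fps_of_poly (H $$ (k, j))) = fps_of_poly r \<and>
        (r = 0 \<or> degree r < \<nu> j)" by blast
  qed (use tri(1) diag dims(5) i that in auto)
  have "(\<Sum>k<dim_row M. W i k * fps_of_poly (H $$ (k, i))) =
      (\<Sum>k<dim_row M. if k = i then W i i * fps_of_poly (H $$ (i, i)) else 0)"
  proof (rule sum.cong)
    fix k assume "k \<in> {..<dim_row M}"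
    then show "W i k * fps_of_poly (H $$ (k, i)) =
        (if k = i then W i i * fps_of_poly (H $$ (i, i)) else 0)"
      using W0[of k] tri(1)[of k i] i by (cases k i rule: linorder_cases) auto
  qed simp
  then have "fps_X ^ \<nu>' i = W i i * fps_X ^ \<nu> i"
    using W[of i i] i dims diag diag' by (simp add: fps_of_poly_monom')
  then have "fps_X ^ \<nu> i dvd (fps_X ^ \<nu>' i :: 'a fps)" by (metis dvd_triv_right)
  then show ?thesis by (simp add: fps_dvd_iff)
qed

text \<open>
  With equal diagonals, the difference of corresponding rows is a reduced combination of rows.
\<close>
theorem hermite_form_unique:
  assumes H: "is_hermite_form M H" and H': "is_hermite_form M H'"
  shows "H = H'"
proof -
  have dims: "dim_row H = dim_row M" "dim_col H = dim_col M" "dim_row H' = dim_row M"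
    "dim_col H' = dim_col M" "dim_col M \<le> dim_row M"
    using is_hermite_form_dims[OF H] is_hermite_form_dims[OF H'] by simp_all
  have tri: "H $$ (k, j) = 0" "H' $$ (k, j) = 0" if "k < dim_row M" "j < dim_col M" "j < k" for k j
    using is_hermite_form_lower[OF H that] is_hermite_form_lower[OF H' that] by simp_all
  obtain \<nu> where \<nu>: "\<And>i. i < dim_col M \<Longrightarrow> H $$ (i, i) = monom 1 (\<nu> i)"
      "\<And>i j. j < dim_col M \<Longrightarrow> i < j \<Longrightarrow> H $$ (i, j) = 0 \<or> degree (H $$ (i, j)) < \<nu> j"
    by (rule is_hermite_form_exponents[OF H]) (rule that)
  obtain \<nu>' where \<nu>': "\<And>i. i < dim_col M \<Longrightarrow> H' $$ (i, i) = monom 1 (\<nu>' i)"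
      "\<And>i j. j < dim_col M \<Longrightarrow> i < j \<Longrightarrow> H' $$ (i, j) = 0 \<or> degree (H' $$ (i, j)) < \<nu>' j"
    by (rule is_hermite_form_exponents[OF H']) (rule that)
  have \<nu>_eq: "\<nu>' i = \<nu> i" if "i < dim_col M" for i
    using hermite_form_diag_le[OF H H' \<nu>(1) \<nu>'(1) that]
      hermite_form_diag_le[OF H' H \<nu>'(1) \<nu>(1) that] by simp
  obtain W where W: "\<And>i j. i < dim_row M \<Longrightarrow> j < dim_col M \<Longrightarrow>
      fps_of_poly (H' $$ (i, j)) = (\<Sum>k<dim_row M. W i k * fps_of_poly (H $$ (k, j)))"
    by (rule hermite_form_transition[OF H H']) (rule that)
  have "H $$ (i, j) = H' $$ (i, j)" if i: "i < dim_row M" and j: "j < dim_col M" for i j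
  proof -
    define w where "w k = W i k - (if k = i then 1 else 0)" for k
    have comb: "(\<Sum>k<dim_row M. w k * fps_of_poly (H $$ (k, j))) =
        fps_of_poly (H' $$ (i, j) - H $$ (i, j))" if j: "j < dim_col M" for j
    proof -
      have "(\<Sum>k<dim_row M. w k * fps_of_poly (H $$ (k, j))) =
          (\<Sum>k<dim_row M. W i k * fps_of_poly (H $$ (k, j))) -
          (\<Sum>k<dim_row M. if k = i then fps_of_poly (H $$ (k, j)) else 0)"
        unfolding sum_subtractf[symmetric] w_def
        by (intro sum.cong) (auto simp: algebra_simps)
      then show ?thesis using W[OF i j] i by (simp add: fps_of_poly_diff)
    qed
    have small: "H' $$ (i, j) - H $$ (i, j) = 0 \<or> degree (H' $$ (i, j) - H $$ (i, j)) < \<nu> j"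
      if j: "j < dim_col M" for j
    proof (cases i j rule: linorder_cases)
      case less
      have "degree (H' $$ (i, j) - H $$ (i, j)) < \<nu> j"
        if "H' $$ (i, j) \<noteq> 0 \<or> H $$ (i, j) \<noteq> 0"
        using \<nu>(2)[OF j less] \<nu>'(2)[OF j less] \<nu>_eq[OF j] that
        by (auto intro!: degree_diff_less)
      then show ?thesis by force
    next
      case equal
      then show ?thesis using \<nu>(1)[OF j] \<nu>'(1)[OF j] \<nu>_eq[OF j] by simp
    next
      case greater
      then show ?thesis using tri[OF i j] by simp
    qed
    have w0: "w k = 0" if "k < dim_col M" for k
      by (rule small_combination_zero[where h = "\<lambda>k j. H $$ (k, j)" and K = "dim_col M"
            and n = "dim_row M" and m = "dim_col M" and \<nu> = \<nu>])
         (use tri \<nu>(1) dims comb small that in blast)+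
    have "(\<Sum>k<dim_row M. w k * fps_of_poly (H $$ (k, j))) = 0"
    proof (rule sum.neutral, rule ballI)
      fix k assume "k \<in> {..<dim_row M}"
      then show "w k * fps_of_poly (H $$ (k, j)) = 0"
        using w0[of k] tri(1)[of k j] j by (cases "k < dim_col M") auto
    qed
    then have "fps_of_poly (H' $$ (i, j) - H $$ (i, j)) = fps_of_poly 0"
      using comb[OF j] by simp
    then show ?thesis by (simp only: fps_of_poly_eq_iff) simp
  qed
  then show ?thesis using dims by (intro eq_matI) auto
qed

corollary hermite_form_eqI: "is_hermite_form M H \<Longrightarrow> hermite_form M = H"
  unfolding hermite_form_def using hermite_form_unique by blast

text \<open>
  The determinants of both factors are units, so the adjugate provides an inverse.
\<close>
lemma mat_left_inverse_of_right_inverse: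
  fixes U V :: "'b::idom mat"
  assumes U: "U \<in> carrier_mat n n" and V: "V \<in> carrier_mat n n" and UV: "U * V = 1\<^sub>m n"
  shows "V * U = 1\<^sub>m n"
proof -
  have det: "det U * det V = 1"
    using det_mult[OF U V] by (simp add: UV)
  define A where "A = det U \<cdot>\<^sub>m adj_mat V"
  have A: "A \<in> carrier_mat n n" using adj_mat(1)[OF V] by (simp add: A_def)
  have VA: "V * A = 1\<^sub>m n"
  proof -
    have "V * A = det U \<cdot>\<^sub>m (det V \<cdot>\<^sub>m 1\<^sub>m n)"
      unfolding A_def using adj_mat[OF V] V by (simp add: mult_smult_distrib)
    also have "\<dots> = 1\<^sub>m n" using det by (intro eq_matI) auto
    finally show ?thesis .
  qed
  have "U = U * (V * A)" unfolding VA using U by simp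
  also have "\<dots> = (U * V) * A" by (rule assoc_mult_mat[OF U V A, symmetric])
  also have "\<dots> = A" unfolding UV using A by simp
  finally show ?thesis using VA by simp
qed

text \<open>
  It is enough that the rows of \<open>M\<close> and of \<open>H\<close> are combinations of each other: \<open>U V H = H\<close> forces
  \<open>U V = 1\<close>, because the rows of \<open>H\<close> are independent.
\<close>
lemma is_hermite_formI:
  fixes H :: "'a::field poly mat"
  assumes dims: "M \<in> carrier_mat m m" "H \<in> carrier_mat m m"
    and U: "U \<in> carrier_mat m m" "U * M = map_mat fps_of_poly H"
    and V: "V \<in> carrier_mat m m" "V * map_mat fps_of_poly H = M"
    and tri: "\<And>i j. i < m \<Longrightarrow> j < i \<Longrightarrow> H $$ (i, j) = 0"
    and diag: "\<And>i. i < m \<Longrightarrow> H $$ (i, i) = monom 1 (\<nu> i)"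
    and small: "\<And>i j. j < m \<Longrightarrow> i < j \<Longrightarrow> H $$ (i, j) = 0 \<or> degree (H $$ (i, j)) < \<nu> j"
  shows "is_hermite_form M H"
proof -
  have Hc: "map_mat fps_of_poly H \<in> carrier_mat m m" using dims by auto
  have UVc: "U * V \<in> carrier_mat m m" using U V by simp
  have "(U * V) * map_mat fps_of_poly H = U * (V * map_mat fps_of_poly H)"
    by (rule assoc_mult_mat[OF U(1) V(1) Hc])
  then have UVH: "(U * V) * map_mat fps_of_poly H = map_mat fps_of_poly H"
    by (simp only: U(2) V(2))
  have UV: "U * V = 1\<^sub>m m"
  proof (rule eq_matI)
    fix i k assume "i < dim_row (1\<^sub>m m :: 'a fps mat)" "k < dim_col (1\<^sub>m m :: 'a fps mat)"
    then have i: "i < m" and k: "k < m" by auto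
    define w where "w k = (U * V) $$ (i, k) - (if k = i then 1 else 0)" for k
    have "(\<Sum>k<m. w k * fps_of_poly (H $$ (k, j))) = fps_of_poly 0" if j: "j < m" for j
    proof -
      have "(\<Sum>k<m. (U * V) $$ (i, k) * fps_of_poly (H $$ (k, j))) = fps_of_poly (H $$ (i, j))"
      proof -
        have "((U * V) * map_mat fps_of_poly H) $$ (i, j) =
            (\<Sum>k<m. (U * V) $$ (i, k) * map_mat fps_of_poly H $$ (k, j))"
          by (rule mult_mat_entry[OF UVc Hc i j])
        also have "\<dots> = (\<Sum>k<m. (U * V) $$ (i, k) * fps_of_poly (H $$ (k, j)))"
          using j dims by (intro sum.cong) auto
        finally have "(map_mat fps_of_poly H) $$ (i, j) =
            (\<Sum>k<m. (U * V) $$ (i, k) * fps_of_poly (H $$ (k, j)))"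
          unfolding UVH .
        then show ?thesis using i j dims by simp
      qed
      moreover have "(\<Sum>k<m. w k * fps_of_poly (H $$ (k, j))) =
          (\<Sum>k<m. (U * V) $$ (i, k) * fps_of_poly (H $$ (k, j))) -
          (\<Sum>k<m. if k = i then fps_of_poly (H $$ (k, j)) else 0)"
        unfolding sum_subtractf[symmetric] w_def
        by (intro sum.cong) (auto simp: algebra_simps)
      ultimately show ?thesis using i by simp
    qed
    then have "w k = 0"
      by (intro small_combination_zero[where h = "\<lambda>k j. H $$ (k, j)" and K = m and n = m
            and m = m and \<nu> = \<nu>]) (use tri diag k in blast)+
    then show "(U * V) $$ (i, k) = 1\<^sub>m m $$ (i, k)"
      using i k by (simp add: w_def)
  qed (use UVc in auto)
  have "invertible_mat U"
    unfolding invertible_mat_def inverts_mat_def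
    using U(1) V(1) UV mat_left_inverse_of_right_inverse[OF U(1) V(1) UV] by auto
  then show ?thesis
    unfolding is_hermite_form_def using dims U tri diag small
    by (intro conjI bexI[of _ U] exI[of _ \<nu>]) auto
qed

text \<open>
  The matrix lists coefficients from the highest to the lowest power of \<open>Y\<close>, so an upper triangular
  row \<open>m - 1 - d\<close> is a polynomial of degree \<open>d\<close>. The reduced triangular basis of the lattice thus is a
  Hermite normal form for any \<open>m\<close> generators, and by uniqueness it is the one computed.
\<close>
theorem (in stable_lattice) hermite_form_basis:
  assumes q: "\<And>i. i < m \<Longrightarrow> q i \<in> \<Lambda>"
    and gen: "\<And>r. r \<in> \<Lambda> \<Longrightarrow> \<exists>u. r = (\<Sum>i<m. smult (u i) (q i))"
  obtains b where
    "\<And>d. d < m \<Longrightarrow> b d \<in> \<Lambda> \<and> degree (b d) = d \<and> coeff (b d) d = fps_X ^ lead_exp d"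
    "\<And>r. r \<in> \<Lambda> \<Longrightarrow> \<exists>u. r = (\<Sum>d<m. smult (u d) (b d))"
    "\<And>d j. d < m \<Longrightarrow> j < m \<Longrightarrow>
       fps_of_poly (hermite_form (mat m m (\<lambda>(i, j). coeff (q i) (m - 1 - j))) $$ (m - 1 - d, j)) =
       coeff (b d) (m - 1 - j)"
proof -
  obtain b where b:
    "\<And>d. d < m \<Longrightarrow> b d \<in> \<Lambda> \<and> degree (b d) = d \<and> coeff (b d) d = fps_X ^ lead_exp d"
    and red: "\<And>d j. d < m \<Longrightarrow> j < d \<Longrightarrow> coeff (b d) j = fps_cutoff (lead_exp j) (coeff (b d) j)"
    and gen_b: "\<And>r. r \<in> \<Lambda> \<Longrightarrow> \<exists>u. r = (\<Sum>d<m. smult (u d) (b d))"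
    using reduced_triangular_basis by blast
  define M where "M = mat m m (\<lambda>(i, j). coeff (q i) (m - 1 - j))"
  \<comment> \<open>All coefficients of the basis are polynomials of degree at most \<open>D\<close>, so truncation does not change them.\<close>
  define H where "H = mat m m (\<lambda>(i, j). truncate_fps (Suc D) (coeff (b (m - 1 - i)) (m - 1 - j)))"
  have trunc: "truncate_fps (Suc D) (coeff (b d) j) =
      (if j < d then truncate_fps (lead_exp j) (coeff (b d) j)
       else if j = d then monom 1 (lead_exp d) else 0)" if "d < m" for d j
  proof -
    have "lead_exp d \<le> D" "j < d \<Longrightarrow> lead_exp j \<le> D"
      using lead_exp_le_denom that by auto
    moreover have "fps_nth (coeff (b d) j) i = 0" if "j < d" "\<not> i < lead_exp j" for i
      using arg_cong[OF red[OF \<open>d < m\<close> that(1)], of "\<lambda>c. fps_nth c i"] that(2) by simp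
    moreover have "coeff (b d) j = 0" if "j > d"
      using b[OF \<open>d < m\<close>] that by (auto intro: coeff_eq_0)
    ultimately show ?thesis
      using b[OF that] by (cases j d rule: linorder_cases)
        (auto simp: poly_eq_iff coeff_truncate_fps fps_X_power_nth)
  qed
  have fps_trunc: "fps_of_poly (truncate_fps (Suc D) (coeff (b d) j)) = coeff (b d) j"
    if "d < m" for d j
    using trunc[OF that, of j] b[OF that] red[OF that, of j]
    by (cases j d rule: linorder_cases) (auto simp: fps_of_poly_monom' coeff_eq_0)
  have H_entry: "fps_of_poly (H $$ (i, j)) = coeff (b (m - 1 - i)) (m - 1 - j)"
    if "i < m" "j < m" for i j
    using fps_trunc[of "m - 1 - i" "m - 1 - j"] that by (simp add: H_def)
  have "\<forall>i. \<exists>u. i < m \<longrightarrow> b (m - 1 - i) = (\<Sum>k<m. smult (u k) (q k))"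
  proof
    fix i
    show "\<exists>u. i < m \<longrightarrow> b (m - 1 - i) = (\<Sum>k<m. smult (u k) (q k))"
      using gen[of "b (m - 1 - i)"] b[of "m - 1 - i"] by auto
  qed
  then obtain u where u: "\<And>i. i < m \<Longrightarrow> b (m - 1 - i) = (\<Sum>k<m. smult (u i k) (q k))" by metis
  have "\<forall>i. \<exists>v. i < m \<longrightarrow> q i = (\<Sum>d<m. smult (v d) (b d))"
    using gen_b q by blast
  then obtain v where v: "\<And>i. i < m \<Longrightarrow> q i = (\<Sum>d<m. smult (v i d) (b d))" by metis
  have "is_hermite_form M H"
  proof (rule is_hermite_formI[where m = m and \<nu> = "\<lambda>j. lead_exp (m - 1 - j)"
        and U = "mat m m (\<lambda>(i, k). u i k)" and V = "mat m m (\<lambda>(i, k). v i (m - 1 - k))"])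
    show "mat m m (\<lambda>(i, k). u i k) * M = map_mat fps_of_poly H"
    proof (rule eq_matI)
      fix i j assume "i < dim_row (map_mat fps_of_poly H)" "j < dim_col (map_mat fps_of_poly H)"
      then have i: "i < m" and j: "j < m" by (auto simp: H_def)
      have "(mat m m (\<lambda>(i, k). u i k) * M) $$ (i, j) =
          (\<Sum>k<m. mat m m (\<lambda>(i, k). u i k) $$ (i, k) * M $$ (k, j))"
        by (rule mult_mat_entry) (use i j in \<open>auto simp: M_def\<close>)
      also have "\<dots> = (\<Sum>k<m. u i k * coeff (q k) (m - 1 - j))"
        using i j by (intro sum.cong) (auto simp: M_def)
      also have "\<dots> = coeff (b (m - 1 - i)) (m - 1 - j)"
        unfolding u[OF i] by (simp add: coeff_sum)
      also have "\<dots> = map_mat fps_of_poly H $$ (i, j)"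
        using H_entry[OF i j] i j by (simp add: H_def)
      finally show "(mat m m (\<lambda>(i, k). u i k) * M) $$ (i, j) = map_mat fps_of_poly H $$ (i, j)" .
    qed (auto simp: M_def H_def)
    show "mat m m (\<lambda>(i, k). v i (m - 1 - k)) * map_mat fps_of_poly H = M"
    proof (rule eq_matI)
      fix i j assume "i < dim_row M" "j < dim_col M"
      then have i: "i < m" and j: "j < m" by (auto simp: M_def)
      have "(mat m m (\<lambda>(i, k). v i (m - 1 - k)) * map_mat fps_of_poly H) $$ (i, j) =
          (\<Sum>k<m. mat m m (\<lambda>(i, k). v i (m - 1 - k)) $$ (i, k) * map_mat fps_of_poly H $$ (k, j))"
        by (rule mult_mat_entry) (use i j in \<open>auto simp: H_def\<close>)
      also have "\<dots> = (\<Sum>k<m. v i (m - 1 - k) * coeff (b (m - 1 - k)) (m - 1 - j))"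
        using i j H_entry by (intro sum.cong) (auto simp: H_def)
      also have "\<dots> = (\<Sum>d<m. v i d * coeff (b d) (m - 1 - j))"
        by (rule sum.reindex_bij_witness[of _ "\<lambda>d. m - 1 - d" "\<lambda>d. m - 1 - d"]) auto
      also have "\<dots> = M $$ (i, j)"
        using i j v[OF i] by (simp add: M_def coeff_sum)
      finally show "(mat m m (\<lambda>(i, k). v i (m - 1 - k)) * map_mat fps_of_poly H) $$ (i, j) = M $$ (i, j)" .
    qed (auto simp: M_def H_def)
    fix i j assume "j < m" "i < j"
    then have "H $$ (i, j) = truncate_fps (lead_exp (m - 1 - j)) (coeff (b (m - 1 - i)) (m - 1 - j))"
      by (auto simp: H_def trunc)
    then show "H $$ (i, j) = 0 \<or> degree (H $$ (i, j)) < lead_exp (m - 1 - j)"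
      by (cases "lead_exp (m - 1 - j) = 0") (auto intro: degree_truncate_fps)
  qed (auto simp: M_def H_def trunc)
  then have "hermite_form M = H" by (rule hermite_form_eqI)
  then have "fps_of_poly (hermite_form M $$ (m - 1 - d, j)) = coeff (b d) (m - 1 - j)"
    if "d < m" "j < m" for d j
    using H_entry[of "m - 1 - d" j] that by simp
  then show ?thesis using that[OF b gen_b] unfolding M_def by blast
qed

section \<open>From generators to the Hermite basis\<close>

text \<open>
  Clearing denominators is an eventual property of the exponent, hence a common denominator for
  finitely many coefficients exists.
\<close>
lemma eventually_fls_integral:
  fixes x :: "'a::field fls"
  shows "eventually (\<lambda>k. fls_X ^ k * x \<in> range fps_to_fls) sequentially"
  unfolding eventually_sequentially
proof (intro exI allI impI)
  fix k assume k: "nat (- fls_subdegree x) \<le> k"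
  show "fls_X ^ k * x \<in> range fps_to_fls"
  proof (cases "x = 0")
    case False
    have "fls_subdegree (fls_X ^ k * x) = int k + fls_subdegree x"
      using False by (simp add: fls_subdegree_mult)
    then have "0 \<le> fls_subdegree (fls_X ^ k * x)" using k by simp
    then have "fls_X ^ k * x = fps_to_fls (fls_regpart (fls_X ^ k * x))"
      by (simp only: fls_regpart_to_fls_trivial)
    then show ?thesis by (rule range_eqI)
  qed (auto intro: range_eqI[of _ _ 0])
qed

lemma denom_exp_clears:
  assumes "f \<in> set cs"
  shows "fls_X ^ denom_exp g cs * coeff (reduced g f) j \<in> range fps_to_fls"
proof -
  let ?P = "\<lambda>k. \<forall>f\<in>set cs. \<forall>j. fls_X ^ k * coeff (reduced g f) j \<in> range fps_to_fls"
  have "eventually (\<lambda>k. \<forall>f\<in>set cs. \<forall>j\<in>{..degree (reduced g f)}.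
      fls_X ^ k * coeff (reduced g f) j \<in> range fps_to_fls) sequentially"
    by (intro eventually_ball_finite ballI eventually_fls_integral) auto
  then obtain k where k: "\<forall>f\<in>set cs. \<forall>j\<in>{..degree (reduced g f)}.
      fls_X ^ k * coeff (reduced g f) j \<in> range fps_to_fls"
    unfolding eventually_sequentially by blast
  have "?P k"
  proof (intro ballI allI)
    fix f j assume f: "f \<in> set cs"
    show "fls_X ^ k * coeff (reduced g f) j \<in> range fps_to_fls"
    proof (cases "j \<le> degree (reduced g f)")
      case False
      then have "fls_X ^ k * coeff (reduced g f) j = fps_to_fls 0" by (simp add: coeff_eq_0)
      then show ?thesis by (rule range_eqI)
    qed (use k f in auto)
  qed
  then have "?P (denom_exp g cs)" unfolding denom_exp_def by (rule LeastI)
  with assms show ?thesis by blast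
qed

lemma fps_X_power_dvd_fps_of_poly_iff:
  fixes r :: "'a::field poly"
  shows "fps_X ^ k dvd fps_of_poly r \<longleftrightarrow> monom 1 k dvd r"
proof
  assume "monom 1 k dvd r"
  then obtain q where "r = monom 1 k * q" by (rule dvdE)
  then have "fps_of_poly r = fps_X ^ k * fps_of_poly q"
    by (simp add: fps_of_poly_mult fps_of_poly_monom')
  then show "fps_X ^ k dvd fps_of_poly r" by (rule dvdI)
next
  assume "fps_X ^ k dvd fps_of_poly r"
  then obtain q where "fps_of_poly r = fps_X ^ k * q" by (rule dvdE)
  then have "fps_nth (fps_of_poly r) j = 0" if "j < k" for j
    using that by (simp only: fps_X_power_mult_nth) simp
  then show "monom 1 k dvd r" by (simp add: monom_1_dvd_iff')
qed

lemma coeff_hnf_poly: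
  "coeff (hnf_poly g cs d) j =
    (if j < degree g then hermite_form (gens_mat g cs) $$ (degree g - 1 - d, degree g - 1 - j) else 0)"
proof -
  let ?H = "hermite_form (gens_mat g cs)" and ?m = "degree g"
  have "coeff (hnf_poly g cs d) j =
      (\<Sum>l<?m. if l = ?m - 1 - j \<and> j < ?m then ?H $$ (?m - 1 - d, l) else 0)"
    unfolding hnf_poly_def coeff_sum by (intro sum.cong) auto
  also have "\<dots> = (if j < ?m then ?H $$ (?m - 1 - d, ?m - 1 - j) else 0)"
    by (cases "j < ?m") auto
  finally show ?thesis .
qed

text \<open>
  Under these conditions reduction to lowest terms is explicit: \<open>X^\<mu>\<close> divides all coefficients, and no
  higher power divides the leading one.
\<close>
locale triangular_normal_form =
  fixes g :: "'a::field fps poly" and cs :: "'a fls poly list" and d \<mu> :: nat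
  assumes degree_hnf: "degree (hnf_poly g cs d) = d"
    and lead_hnf: "fps_of_poly (coeff (hnf_poly g cs d) d) = fps_X ^ \<mu>"
    and le_denom: "\<mu> \<le> denom_exp g cs"
    and dvd_hnf: "\<And>j. fps_X ^ \<mu> dvd fps_of_poly (coeff (hnf_poly g cs d) j)"
begin

lemma lead_hnf_poly: "coeff (hnf_poly g cs d) d = monom 1 \<mu>"
  using lead_hnf by (simp only: fps_of_poly_monom'[symmetric] fps_of_poly_eq_iff)

lemma cancel_exp_eq: "cancel_exp g cs d = \<mu>"
  unfolding cancel_exp_def
proof (rule Max_eqI)
  show "finite {k. k \<le> denom_exp g cs \<and> [:monom 1 k:] dvd hnf_poly g cs d}"
    by (rule finite_subset[of _ "{..denom_exp g cs}"]) auto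
  show "\<mu> \<in> {k. k \<le> denom_exp g cs \<and> [:monom 1 k:] dvd hnf_poly g cs d}"
    using le_denom dvd_hnf by (simp add: const_poly_dvd_iff fps_X_power_dvd_fps_of_poly_iff)
  fix k assume "k \<in> {k. k \<le> denom_exp g cs \<and> [:monom 1 k:] dvd hnf_poly g cs d}"
  then have "monom 1 k dvd (monom 1 \<mu> :: 'a poly)"
    using lead_hnf_poly by (metis const_poly_dvd_iff mem_Collect_eq)
  then have "fps_X ^ k dvd (fps_X ^ \<mu> :: 'a fps)"
    by (simp only: fps_X_power_dvd_fps_of_poly_iff[symmetric] fps_of_poly_monom')
  then show "k \<le> \<mu>" by (simp add: fps_dvd_iff)
qed

lemma hnf_poly_eq: "hnf_poly g cs d = smult (monom 1 \<mu>) (hnf_num g cs d)"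
proof -
  have "[:monom 1 \<mu>:] dvd hnf_poly g cs d"
    using dvd_hnf by (simp add: const_poly_dvd_iff fps_X_power_dvd_fps_of_poly_iff)
  then have "[:monom 1 \<mu>:] * hnf_num g cs d = hnf_poly g cs d"
    unfolding hnf_num_def cancel_exp_eq by (rule dvd_mult_div_cancel)
  then show ?thesis by simp
qed

lemma hnf_num_monic: "degree (hnf_num g cs d) = d \<and> lead_coeff (hnf_num g cs d) = 1"
proof -
  have deg: "degree (hnf_num g cs d) = d"
    using degree_hnf unfolding hnf_poly_eq by simp
  have "monom 1 \<mu> * coeff (hnf_num g cs d) d = monom 1 \<mu> * 1"
    using lead_hnf_poly unfolding hnf_poly_eq by simp
  then have "coeff (hnf_num g cs d) d = 1"
    by (simp only: mult_cancel_left) simp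
  with deg show ?thesis by simp
qed

lemma frac_X_hnf_num:
  "frac_X (map_poly fps_of_poly (hnf_num g cs d)) (hnf_exp g cs d) =
    smult (1 / fls_X ^ denom_exp g cs) (lift_poly (map_poly fps_of_poly (hnf_poly g cs d)))"
proof -
  have "map_poly fps_of_poly (hnf_poly g cs d) =
      smult (fps_X ^ \<mu>) (map_poly fps_of_poly (hnf_num g cs d))"
    unfolding hnf_poly_eq
    by (rule poly_eqI) (simp add: coeff_map_poly fps_of_poly_mult fps_of_poly_monom')
  moreover have "1 / fls_X ^ (denom_exp g cs - \<mu>) = 1 / fls_X ^ denom_exp g cs * (fls_X ^ \<mu> :: 'a fls)"
  proof -
    have "fls_X ^ denom_exp g cs = fls_X ^ (denom_exp g cs - \<mu>) * (fls_X ^ \<mu> :: 'a fls)"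
      using le_denom by (simp add: power_add[symmetric])
    then show ?thesis by simp
  qed
  ultimately show ?thesis
    by (simp only: frac_X_def hnf_exp_def cancel_exp_eq power_int_of_nat lift_poly_smult
        fps_to_fls_power fps_X_to_fls smult_smult)
qed

end

text \<open>
  What the procedure uses about its input, separated from where the generators come from. Closure under
  addition and the description of the constants turn the integral elements of degree less than
  \<open>deg g\<close>, multiplied by the common denominator, into a stable lattice; its Hermite basis is monic in
  lowest terms, and dividing by the denominator gives back generators of all integral elements.
\<close>
theorem hermite_procedure:
  fixes g :: "'a::field fps poly"
  assumes deg: "degree g \<ge> 1" and len: "length cs = degree g"
    and integral: "\<And>f. f \<in> set cs \<Longrightarrow> integral_mod g f"
    and generate: "\<And>f. integral_mod g f \<Longrightarrow>
      \<exists>v. lift_poly g dvd f - (\<Sum>k<degree g. smult (fps_to_fls (v k)) (cs ! k))"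
    and add: "\<And>f f'. integral_mod g f \<Longrightarrow> integral_mod g f' \<Longrightarrow> integral_mod g (f + f')"
    and const: "\<And>x. integral_mod g [:x:] \<Longrightarrow> x \<in> range fps_to_fls"
  shows "monic_triangular_integral_basis g (hnf_num g cs) (hnf_exp g cs)"
proof -
  define m where "m = degree g"
  define D where "D = denom_exp g cs"
  define \<xi> :: "'a fls" where "\<xi> = 1 / fls_X ^ D"
  define scaled :: "'a fps poly \<Rightarrow> 'a fls poly" where "scaled q = smult \<xi> (lift_poly q)" for q
  define \<Lambda> where "\<Lambda> = {q. degree q < m \<and> integral_mod g (scaled q)}"
  define q where "q k = map_poly fls_regpart (smult (fls_X ^ D) (reduced g (cs ! k)))" for k
  have m: "0 < m" using deg by (simp add: m_def)
  have g0: "lift_poly g \<noteq> 0" using deg by auto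
  have "(fls_X ^ D :: 'a fls) \<noteq> 0" by simp
  then have \<xi>: "\<xi> \<noteq> 0" "\<xi> * fls_X ^ D = 1"
    unfolding \<xi>_def by (simp_all only: divide_eq_0_iff one_neq_zero simp_thms
        times_divide_eq_left mult_1_left divide_self_if if_False)
  have scaled_add: "scaled (r + r') = scaled r + scaled r'" for r r'
    by (simp add: scaled_def lift_poly_arith smult_add_right)
  have scaled_mult: "scaled (r * r') = lift_poly r * scaled r'" for r r'
    by (simp add: scaled_def lift_poly_arith)
  have scaled_smult: "scaled (smult x r) = smult (fps_to_fls x) (scaled r)" for x r
    by (simp add: scaled_def mult.commute)
  have degree_scaled: "degree (scaled r) = degree r" for r
    using \<xi>(1) by (simp add: scaled_def)
  have scaled_sum: "scaled (\<Sum>k<m. smult (u k) (r k)) = (\<Sum>k<m. smult (fps_to_fls (u k)) (scaled (r k)))"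
    for u r
  proof -
    have "scaled 0 = 0" by (simp add: scaled_def)
    then have "scaled (sum F A) = (\<Sum>k\<in>A. scaled (F k))" for F :: "nat \<Rightarrow> 'a fps poly" and A
      by (induction A rule: infinite_finite_induct) (simp_all add: scaled_add)
    then show ?thesis by (simp add: scaled_smult)
  qed
  have scaled_inj: "r = r'" if "scaled r = scaled r'" for r r'
    using that \<xi>(1) by (simp add: scaled_def smult_eq_iff lift_poly_hom.eq_iff)
  have scaled_one: "scaled [:fps_X ^ D:] = 1"
    using \<xi>(2) by (simp add: scaled_def fps_to_fls_power)
  have degree_reduced: "degree (reduced g f) < m" for f
    using degree_mod_less[of "lift_poly g" f] g0 m
    by (auto simp: reduced_def m_def)
  have reduced_cong: "lift_poly g dvd f - reduced g f" for f
    by (simp add: reduced_def minus_mod_eq_mult_div)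
  interpret stable_lattice \<Lambda> m D
  proof
    fix r r' x assume r: "r \<in> \<Lambda>"
    then show "degree r < m" by (simp add: \<Lambda>_def)
    show "r + r' \<in> \<Lambda>" if "r' \<in> \<Lambda>"
      using r that add degree_add_less by (auto simp: \<Lambda>_def scaled_add)
    show "smult x r \<in> \<Lambda>"
      using integral_mod_smult[of g "scaled r" x] r le_less_trans[OF degree_smult_le[of x r], of m]
      unfolding \<Lambda>_def mem_Collect_eq scaled_smult by blast
    show "pCons 0 r \<in> \<Lambda>" if "Suc (degree r) < m"
    proof -
      have "scaled (pCons 0 r) = lift_poly [:0, 1:] * scaled r"
        unfolding scaled_mult[symmetric] by simp
      then have "integral_mod g (scaled (pCons 0 r))"
        using integral_mod_scale[of g "scaled r" "[:0, 1:]"] r by (simp add: \<Lambda>_def)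
      moreover have "degree (pCons 0 r) < m"
        using that degree_pCons_le[of 0 r] by simp
      ultimately show ?thesis by (simp add: \<Lambda>_def)
    qed
  next
    show "[:fps_X ^ D:] \<in> \<Lambda>"
      using m integral_mod_lift[of g 1] by (simp add: \<Lambda>_def scaled_one)
  next
    fix x assume "[:x:] \<in> \<Lambda>"
    then have "integral_mod g [:\<xi> * fps_to_fls x:]"
      by (simp add: \<Lambda>_def scaled_def)
    then obtain y where y: "\<xi> * fps_to_fls x = fps_to_fls y"
      using const by blast
    have "fps_to_fls x = fls_X ^ D * (\<xi> * fps_to_fls x)"
      using \<xi>(2) by (simp add: mult.commute mult.left_commute)
    then have "fps_to_fls x = fps_to_fls (fps_X ^ D * y)"
      by (simp only: y fps_to_fls_hom.hom_mult fps_to_fls_power fps_X_to_fls)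
    then have "x = fps_X ^ D * y" by (simp only: fps_to_fls_eq_iff)
    then show "fps_X ^ D dvd x" by (rule dvdI)
  qed
  have coeff_q: "fps_to_fls (coeff (q k) j) = fls_X ^ D * coeff (reduced g (cs ! k)) j" if "k < m" for k j
  proof -
    have "cs ! k \<in> set cs" using that len by (simp add: m_def)
    then obtain y where "fls_X ^ D * coeff (reduced g (cs ! k)) j = fps_to_fls y"
      using denom_exp_clears[of "cs ! k" cs g j] by (auto simp: D_def)
    then show ?thesis by (simp add: q_def coeff_map_poly)
  qed
  have scaled_q: "scaled (q k) = reduced g (cs ! k)" if "k < m" for k
    using coeff_q[OF that] \<xi>(2) by (intro poly_eqI) (simp add: scaled_def mult.assoc[symmetric])
  have q_mem: "q k \<in> \<Lambda>" if "k < m" for k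
  proof -
    have "integral_mod g (cs ! k)" using that integral len by (simp add: m_def)
    then have "integral_mod g (scaled (q k))"
      using integral_mod_cong[OF reduced_cong] scaled_q[OF that] by simp
    moreover have "degree (q k) < m"
      using degree_reduced[of "cs ! k"] degree_scaled[of "q k"] scaled_q[OF that] by simp
    ultimately show ?thesis by (simp add: \<Lambda>_def)
  qed
  have generate': "\<exists>v. lift_poly g dvd f - scaled (\<Sum>k<m. smult (v k) (q k))"
    if f: "integral_mod g f" for f
  proof -
    obtain v where v: "lift_poly g dvd f - (\<Sum>k<m. smult (fps_to_fls (v k)) (cs ! k))"
      using generate[OF f] by (auto simp: m_def)
    have "lift_poly g dvd (\<Sum>k<m. smult (fps_to_fls (v k)) (cs ! k - reduced g (cs ! k)))"
      by (intro dvd_sum dvd_smult reduced_cong)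
    from dvd_add[OF v this]
    have "lift_poly g dvd f - (\<Sum>k<m. smult (fps_to_fls (v k)) (reduced g (cs ! k)))"
      by (simp add: smult_diff_right sum_subtractf)
    then have "lift_poly g dvd f - scaled (\<Sum>k<m. smult (v k) (q k))"
      unfolding scaled_sum by (simp add: scaled_q)
    then show ?thesis by (rule exI[of _ v])
  qed
  have gen_q: "\<exists>v. r = (\<Sum>k<m. smult (v k) (q k))" if r: "r \<in> \<Lambda>" for r
  proof -
    obtain v where v: "lift_poly g dvd scaled r - scaled (\<Sum>k<m. smult (v k) (q k))"
      using generate' r by (auto simp: \<Lambda>_def)
    have "(\<Sum>k<m. smult (v k) (q k)) \<in> \<Lambda>" by (intro sum smult) (simp add: q_mem)
    then have "degree (scaled r - scaled (\<Sum>k<m. smult (v k) (q k))) < m"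
      using r degree_less by (intro degree_diff_less) (auto simp: degree_scaled)
    then have "scaled r - scaled (\<Sum>k<m. smult (v k) (q k)) = 0"
      using v dvd_imp_degree_le[of "lift_poly g"] by (fastforce simp: m_def)
    then show ?thesis using scaled_inj by auto
  qed
  have gens_mat: "gens_mat g cs = mat m m (\<lambda>(i, j). coeff (q i) (m - 1 - j))"
    unfolding gens_mat_def len m_def[symmetric] D_def[symmetric]
    by (simp add: q_def coeff_map_poly)
  obtain b where b:
    "\<And>d. d < m \<Longrightarrow> b d \<in> \<Lambda> \<and> degree (b d) = d \<and> coeff (b d) d = fps_X ^ lead_exp d"
    and gen_b: "\<And>r. r \<in> \<Lambda> \<Longrightarrow> \<exists>u. r = (\<Sum>d<m. smult (u d) (b d))"
    and entry: "\<And>d j. d < m \<Longrightarrow> j < m \<Longrightarrow>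
       fps_of_poly (hermite_form (gens_mat g cs) $$ (m - 1 - d, j)) = coeff (b d) (m - 1 - j)"
    using hermite_form_basis[OF q_mem gen_q] unfolding gens_mat by blast
  have hnf_b: "fps_of_poly (coeff (hnf_poly g cs d) j) = coeff (b d) j" if d: "d < m" for d j
  proof (cases "j < m")
    case True
    then show ?thesis
      using entry[OF d, of "m - 1 - j"] by (simp add: coeff_hnf_poly m_def[symmetric])
  next
    case False
    then show ?thesis
      using b[OF d] d by (simp add: coeff_hnf_poly m_def[symmetric] coeff_eq_0)
  qed
  have map_hnf: "map_poly fps_of_poly (hnf_poly g cs d) = b d" if "d < m" for d
    using hnf_b[OF that] by (intro poly_eqI) (simp add: coeff_map_poly)
  have tnf: "triangular_normal_form g cs d (lead_exp d)" if d: "d < m" for d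
  proof
    have "degree (map_poly fps_of_poly (hnf_poly g cs d)) = degree (hnf_poly g cs d)"
    proof (rule Polynomial.degree_map_poly)
      fix x :: "'a poly" assume "x \<noteq> 0"
      then have "fps_of_poly x \<noteq> fps_of_poly 0" by (subst fps_of_poly_eq_iff)
      then show "fps_of_poly x \<noteq> 0" by simp
    qed
    then show "degree (hnf_poly g cs d) = d" using map_hnf[OF d] b[OF d] by simp
    show "fps_of_poly (coeff (hnf_poly g cs d) d) = fps_X ^ lead_exp d"
      using hnf_b[OF d] b[OF d] by simp
    show "lead_exp d \<le> denom_exp g cs" using lead_exp_le_denom[OF d] by (simp add: D_def)
    show "fps_X ^ lead_exp d dvd fps_of_poly (coeff (hnf_poly g cs d) j)" for j
      unfolding hnf_b[OF d] using b[OF d] d by (intro lead_exp_dvd_coeff) auto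
  qed
  define F where "F d = frac_X (map_poly fps_of_poly (hnf_num g cs d)) (hnf_exp g cs d)" for d
  have F: "F d = scaled (b d)" if d: "d < m" for d
    unfolding F_def triangular_normal_form.frac_X_hnf_num[OF tnf[OF d]] map_hnf[OF d]
    by (simp only: scaled_def \<xi>_def D_def)
  have sum_F: "(\<Sum>d<m. smult (fps_to_fls (u d)) (F d)) = scaled (\<Sum>d<m. smult (u d) (b d))" for u
    unfolding scaled_sum by (simp add: F)
  have "integral_basis g ((\<lambda>d. residue g (F d)) ` {..<degree g})"
  proof (subst integral_basis_triangular_iff)
    fix d assume "d < degree g"
    then have d: "d < m" by (simp add: m_def)
    have "coeff (b d) d \<noteq> 0" using b[OF d] by simp
    then have "b d \<noteq> 0" by auto
    then have "scaled (b d) \<noteq> 0" using \<xi>(1) by (simp add: scaled_def)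
    then show "F d \<noteq> 0 \<and> degree (F d) = d"
      using b[OF d] by (simp add: F[OF d] degree_scaled)
  next
    show "\<forall>f. integral_mod g f \<longleftrightarrow>
        (\<exists>u. lift_poly g dvd f - (\<Sum>d<degree g. smult (fps_to_fls (u d)) (F d)))"
      unfolding m_def[symmetric] sum_F
    proof (intro allI iffI)
      fix f assume "integral_mod g f"
      then obtain v where v: "lift_poly g dvd f - scaled (\<Sum>k<m. smult (v k) (q k))"
        using generate' by blast
      have "(\<Sum>k<m. smult (v k) (q k)) \<in> \<Lambda>" by (intro sum smult) (simp add: q_mem)
      then show "\<exists>u. lift_poly g dvd f - scaled (\<Sum>d<m. smult (u d) (b d))"
        using gen_b v by metis
    next
      fix f assume "\<exists>u. lift_poly g dvd f - scaled (\<Sum>d<m. smult (u d) (b d))"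
      then obtain u where u: "lift_poly g dvd f - scaled (\<Sum>d<m. smult (u d) (b d))" ..
      have "(\<Sum>d<m. smult (u d) (b d)) \<in> \<Lambda>" using b by (intro sum smult) simp
      then show "integral_mod g f"
        using integral_mod_cong[OF u] by (simp add: \<Lambda>_def)
    qed
  qed
  then have basis: "integral_basis g (triangular_set g (hnf_num g cs) (hnf_exp g cs))"
    by (simp add: triangular_set_def F_def)
  have monic_num: "degree (hnf_num g cs d) = d \<and> lead_coeff (hnf_num g cs d) = 1" if "d < degree g" for d
    using triangular_normal_form.hnf_num_monic[OF tnf, of d] that unfolding m_def by blast
  have "hnf_num g cs 0 = 1"
    using monic_num[of 0] m unfolding m_def by (auto elim!: degree_eq_zeroE)
  moreover have "hnf_exp g cs 0 = 0"
    using triangular_normal_form.cancel_exp_eq[OF tnf[OF m]] lead_exp_0[OF m]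
    by (simp add: hnf_exp_def D_def)
  ultimately show ?thesis
    unfolding monic_triangular_integral_basis_def using basis monic_num by blast
qed

theorem corollary39:
  fixes g :: "'a::field_char_0 fps poly"
    and s :: nat
    and gs :: "nat \<Rightarrow> 'a fps poly"
    and p :: "nat \<Rightarrow> nat \<Rightarrow> 'a fps poly"
    and e :: "nat \<Rightarrow> nat \<Rightarrow> int"
    and h a b :: "nat \<Rightarrow> 'a fps poly"
    and c :: "nat \<Rightarrow> nat"
    and Bt :: "nat \<Rightarrow> 'a fls poly set"
    and cs :: "'a fls poly list"
  assumes "squarefree g" and "lead_coeff g = 1" and "degree g \<ge> 1"
    and "g = (\<Prod>i<s. gs i)"
    and "\<And>i. i < s \<Longrightarrow> irreducible (gs i)"
    and "\<And>i. i < s \<Longrightarrow> lead_coeff (gs i) = 1"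
    and "\<And>i. i < s \<Longrightarrow> p i 0 = 1 \<and> e i 0 = 0"
    and "\<And>i d. i < s \<Longrightarrow> d < degree (gs i) \<Longrightarrow>
           degree (p i d) = d \<and> lead_coeff (p i d) = 1"
    and "\<And>i. i < s \<Longrightarrow>
           represents_integral_basis (gs i) {frac_X (p i d) (e i d) | d. d < degree (gs i)}"
    and "\<And>i. i < s \<Longrightarrow> h i = (\<Prod>j\<in>{..<s} - {i}. gs j)"
    and "\<And>i. i < s \<Longrightarrow> a i * gs i + b i * h i = [:fps_X ^ c i:]"
    and "\<And>i. i < s \<Longrightarrow>
           Bt i = {frac_X (b i * h i * p i d) (int (c i) + e i d) | d. d < degree (gs i)}"
    and "distinct cs" and "set cs = (\<Union>i<s. Bt i)"
  shows "monic_triangular_integral_basis g (hnf_num g cs) (hnf_exp g cs)"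
proof -
  interpret factor_bases g s gs p e h a b c
    by unfold_locales (fact assms)+
  have set_cs: "set cs = (\<lambda>(i, d). glued_gen i d) ` (SIGMA i:{..<s}. {..<degree (gs i)})"
    unfolding assms(14) using assms(12) by (fastforce simp: glued_gen_def)
  show ?thesis
  proof (rule hermite_procedure)
    show "integral_mod g f" if "f \<in> set cs" for f
      using that glued_gen_integral by (auto simp: set_cs)
  qed (use assms(3) length_glued_list[OF assms(13) set_cs] glued_list_generate[OF assms(13) set_cs]
      integral_mod_add integral_mod_const in blast)+
qed

end
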